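(* Let $\mathcal Z$ be a Banach space and let $\mathcal Y\subseteq\mathcal Z$ be a closed subspace with $\operatorname{codim}(\mathcal Y)<\infty$. Let $\iota_{\mathcal Y}:\mathcal Y\to\mathcal Z$ denote the canonical injection. If $\mathsf T\in\mathcal L(\mathcal Z,\mathcal Z^\star)$ is Fredholm with $\operatorname{ind}(\mathsf T)=0$, then $\widehat{\mathsf T}:=\iota_{\mathcal Y}^\star\,\mathsf T\,\iota_{\mathcal Y}\in\mathcal L(\mathcal Y,\mathcal Y^\star)$ is Fredholm with $\operatorname{ind}(\widehat{\mathsf T})=0$.
   Context: $\mathcal L(Y,Z)$ denotes bounded linear operators, $Z^\star$ the dual space, and $T^\star$ the Banach-space adjoint (so $\iota_{\mathcal Y}^\star:\mathcal Z^\star\to\mathcal Y^\star$ is restriction of functionals). A bounded operator is Fredholm if its kernel is finite-dimensional and its range is closed with finite codimension; $\operatorname{ind}=\dim\ker-\operatorname{codim}\operatorname{ran}$. *)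

theory Defs
  imports "HOL-Analysis.Analysis" "HOL-Library.Function_Algebras"
begin

(* The norm and topology of the Banach space are those of the type 'z; only the scalar
   multiplication is passed explicitly, so that real ('k = real) and complex ('k = complex)
   Banach spaces are covered at once. Up to isomorphism these are the only instances of 'k
   (Ostrowski / Gelfand-Mazur). Compatibility with scaleR follows from norm_scale by continuity. *)
locale banach_space_over = vector_space sc
  for sc :: "'k::{real_normed_field,banach} \<Rightarrow> 'z::banach \<Rightarrow> 'z" +
  assumes norm_scale: "norm (sc c x) = norm c * norm x"

lemma banach_space_over_real: "banach_space_over (scaleR :: real \<Rightarrow> 'z::banach \<Rightarrow> 'z)"
  by unfold_locales (simp_all add: algebra_simps)

lemma banach_space_over_complex: "banach_space_over ((*) :: complex \<Rightarrow> complex \<Rightarrow> complex)"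
  by unfold_locales (simp_all add: algebra_simps norm_mult)

(* A normed space on a subset of an ambient group; only values on the carrier are meaningful. *)
record ('k, 'v) nspace =
  carrier :: "'v set"
  scl :: "'k \<Rightarrow> 'v \<Rightarrow> 'v"
  nrm :: "'v \<Rightarrow> real"

definition subsp :: "('k \<Rightarrow> 'z \<Rightarrow> 'z) \<Rightarrow> 'z set \<Rightarrow> ('k, 'z::real_normed_vector) nspace" where
  "subsp sc Y = \<lparr>carrier = Y, scl = sc, nrm = norm\<rparr>"

abbreviation whole :: "('k \<Rightarrow> 'z \<Rightarrow> 'z) \<Rightarrow> ('k, 'z::real_normed_vector) nspace" where
  "whole sc \<equiv> subsp sc UNIV"

(* The guard is needed because the locale Metric_space demands a nonnegative distance
   outside the carrier as well. *)
definition ndist :: "('k, 'v::ab_group_add) nspace \<Rightarrow> 'v \<Rightarrow> 'v \<Rightarrow> real" where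
  "ndist X x y = (if x \<in> carrier X \<and> y \<in> carrier X then nrm X (x - y) else 0)"

definition ntopology :: "('k, 'v::ab_group_add) nspace \<Rightarrow> 'v topology" where
  "ntopology X = Metric_space.mtopology (carrier X) (ndist X)"

definition bounded_operators ::
  "('k, 'v::ab_group_add) nspace \<Rightarrow> ('k, 'w::ab_group_add) nspace \<Rightarrow> ('v \<Rightarrow> 'w) set" where
  "bounded_operators X W = {T. T \<in> carrier X \<rightarrow> carrier W \<and>
     (\<forall>x\<in>carrier X. \<forall>y\<in>carrier X. T (x + y) = T x + T y) \<and>
     (\<forall>c. \<forall>x\<in>carrier X. T (scl X c x) = scl W c (T x)) \<and>
     (\<exists>C. \<forall>x\<in>carrier X. nrm W (T x) \<le> C * nrm X x)}"

(* Functionals on carrier X are represented by functions vanishing off carrier X: this makes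
   the representation unique and compatible with the pointwise vector space operations. *)
definition dual ::
  "('k::real_normed_field, 'v::ab_group_add) nspace \<Rightarrow> ('k, 'v \<Rightarrow> 'k) nspace" where
  "dual X = \<lparr>
     carrier = {f \<in> bounded_operators X (whole (*)). \<forall>x. x \<notin> carrier X \<longrightarrow> f x = 0},
     scl = (\<lambda>c f x. c * f x),
     nrm = (\<lambda>f. SUP x\<in>{x \<in> carrier X. nrm X x \<le> 1}. norm (f x))\<rparr>"

(* Adjoint of an operator S defined on X, as a map from the dual of its codomain to dual X. *)
definition adj :: "('k, 'v) nspace \<Rightarrow> ('v \<Rightarrow> 'w) \<Rightarrow> ('w \<Rightarrow> 'k::zero) \<Rightarrow> ('v \<Rightarrow> 'k)" where
  "adj X S f = (\<lambda>x. if x \<in> carrier X then f (S x) else 0)"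

definition inclusion :: "'z set \<Rightarrow> 'z \<Rightarrow> 'z" where
  "inclusion Y = (\<lambda>x\<in>Y. x)"

definition ker :: "('k, 'v) nspace \<Rightarrow> ('v \<Rightarrow> 'w::zero) \<Rightarrow> 'v set" where
  "ker X T = {x \<in> carrier X. T x = 0}"

definition ran :: "('k, 'v) nspace \<Rightarrow> ('v \<Rightarrow> 'w) \<Rightarrow> 'w set" where
  "ran X T = T ` carrier X"

definition finite_dim :: "('k::field, 'v::ab_group_add) nspace \<Rightarrow> 'v set \<Rightarrow> bool" where
  "finite_dim X V \<longleftrightarrow> (\<exists>B. finite B \<and> B \<subseteq> V \<and> V \<subseteq> module.span (scl X) B)"

(* The cosets b + V, b in B, are pairwise distinct and form a finite basis of carrier X / V. *)
definition quotient_basis ::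
  "('k::field, 'v::ab_group_add) nspace \<Rightarrow> 'v set \<Rightarrow> 'v set \<Rightarrow> bool" where
  "quotient_basis X V B \<longleftrightarrow> finite B \<and> B \<subseteq> carrier X \<and>
     (\<forall>x\<in>carrier X. \<exists>!c. (\<forall>b. b \<notin> B \<longrightarrow> c b = 0) \<and> x - (\<Sum>b\<in>B. scl X (c b) b) \<in> V)"

definition finite_codim :: "('k::field, 'v::ab_group_add) nspace \<Rightarrow> 'v set \<Rightarrow> bool" where
  "finite_codim X V \<longleftrightarrow> (\<exists>B. quotient_basis X V B)"

definition codim :: "('k::field, 'v::ab_group_add) nspace \<Rightarrow> 'v set \<Rightarrow> nat" where
  "codim X V = card (SOME B. quotient_basis X V B)"

definition fredholm ::
  "('k::field, 'v::ab_group_add) nspace \<Rightarrow> ('k, 'w::ab_group_add) nspace \<Rightarrow> ('v \<Rightarrow> 'w) \<Rightarrow> bool" where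
  "fredholm X W T \<longleftrightarrow> T \<in> bounded_operators X W \<and> finite_dim X (ker X T) \<and>
     closedin (ntopology W) (ran X T) \<and> finite_codim W (ran X T)"

definition fredholm_index ::
  "('k::field, 'v::ab_group_add) nspace \<Rightarrow> ('k, 'w::ab_group_add) nspace \<Rightarrow> ('v \<Rightarrow> 'w) \<Rightarrow> int" where
  "fredholm_index X W T =
     int (vector_space.dim (scl X) (ker X T)) - int (codim W (ran X T))"

end

theory Submission
  imports Defs
begin

text \<open>Index zero is a statement about relative dimensions of subspaces, and these are additive
  along chains and invariant under linear maps that induce isomorphisms of the quotients. Let
  \<open>n = codim Y\<close> and let \<open>L\<close> be the annihilator of \<open>Y\<close>, which has dimension \<open>n\<close> because the coefficient
  functionals of a complement of \<open>Y\<close> are continuous. Restricting \<open>T\<close> to \<open>Y\<close> lowers the index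
  by \<open>n\<close>; following it by the restriction of functionals, which is onto with kernel \<open>L\<close>, raises
  the index by \<open>n\<close>. The range of the compression is closed because its preimage \<open>L + T Y\<close> is:
  by the open mapping theorem \<open>T Y = T (Y + ker T)\<close> is closed, and adding the finite-dimensional
  \<open>L\<close> preserves closedness. The dual is treated as a closed subspace of the type
  \<open>'z \<Rightarrow>\<^sub>L 'k\<close> of real-linear operators.\<close>

section \<open>Relative dimension\<close>

text \<open>All spaces involved may be infinite-dimensional, so the index cannot be found by
  subtracting dimensions of whole spaces; what is counted are quotients \<open>U/V\<close>, through
  bases of complements, and indices are compared by equations between sums of naturals. The second
  obstacle is the dual of \<open>Y\<close>: its elements are functionals on \<open>Y\<close>
  continued by zero, which in general are not continuous on the whole space and form no Banach space
  type of their own. Finite codimension provides a bounded projection \<open>P\<close> onto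
  \<open>Y\<close>, and \<open>g \<circ> P\<close> is a continuous extension of \<open>g\<close>
  whose norm grows at most by a constant factor. This extension gives the surjectivity of
  restriction and also carries convergence in the dual of \<open>Y\<close> over to the operator
  type, where the closedness of the range is decided.\<close>

definition complement_basis ::
  "('k::field \<Rightarrow> 'v::ab_group_add \<Rightarrow> 'v) \<Rightarrow> 'v set \<Rightarrow> 'v set \<Rightarrow> 'v set \<Rightarrow> bool" where
  "complement_basis sc V U E \<longleftrightarrow> module.subspace sc V \<and> \<not> module.dependent sc E \<and>
     V \<inter> module.span sc E = {0} \<and> U = {v + e |v e. v \<in> V \<and> e \<in> module.span sc E}"

text \<open>A relation rather than a number: it asserts at once that \<open>U/V\<close> is
  finite-dimensional and that its dimension is \<open>d\<close>. Finiteness is kept out of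
  \<open>complement_basis\<close>, so that complements exist for arbitrary nested subspaces and can
  be shown to be finite afterwards.\<close>

definition rel_dim ::
  "('k::field \<Rightarrow> 'v::ab_group_add \<Rightarrow> 'v) \<Rightarrow> 'v set \<Rightarrow> 'v set \<Rightarrow> nat \<Rightarrow> bool" where
  "rel_dim sc V U d \<longleftrightarrow> (\<exists>E. complement_basis sc V U E \<and> finite E \<and> card E = d)"

context vector_space
begin

lemma complement_basis_subset:
  assumes "complement_basis scale V U E"
  shows "V \<subseteq> U" "span E \<subseteq> U" "E \<subseteq> U" "subspace V" "subspace U"
proof -
  have V: "subspace V" and U: "U = {v + e |v e. v \<in> V \<and> e \<in> span E}"
    using assms by (auto simp: complement_basis_def)
  show "V \<subseteq> U"
    unfolding U using span_zero[of E] by force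
  show "span E \<subseteq> U"
    unfolding U using subspace_0[OF V] by force
  then show "E \<subseteq> U"
    using span_superset by blast
  show "subspace V" by (rule V)
  show "subspace U"
    unfolding U by (rule subspace_sums[OF V subspace_span])
qed

text \<open>In a vanishing combination the part over \<open>A\<close> is minus the remaining part,
  so it lies in both spans and vanishes; each part is then trivial by independence.\<close>

lemma independent_Un_disjoint_spans:
  assumes A: "independent A" and B: "independent B" and AB: "span A \<inter> span B = {0}"
  shows "independent (A \<union> B)"
  unfolding independent_explicit_finite_subsets
proof (intro allI impI ballI)
  fix S u v
  assume S: "S \<subseteq> A \<union> B" "finite S" and sum0: "(\<Sum>v\<in>S. scale (u v) v) = 0" and v: "v \<in> S"
  let ?a = "\<Sum>v\<in>S \<inter> A. scale (u v) v" and ?b = "\<Sum>v\<in>S - A. scale (u v) v"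
  have ab: "?a + ?b = 0"
    using sum0 S(2) by (metis sum.Int_Diff)
  have "?a \<in> span A"
    by (intro span_sum span_scale span_base) auto
  moreover have "?b \<in> span B"
    using S(1) by (intro span_sum span_scale span_base) auto
  moreover have "?a = - ?b"
    using ab by (simp add: eq_neg_iff_add_eq_0)
  ultimately have "?a \<in> span A \<inter> span B"
    using span_neg by auto
  then have a0: "?a = 0"
    using AB by auto
  then have b0: "?b = 0"
    using ab by simp
  show "u v = 0"
  proof (cases "v \<in> A")
    case True
    with independentD[OF A _ _ a0] S v show ?thesis by auto
  next
    case False
    have "S - A \<subseteq> B" using S by auto
    with independentD[OF B _ _ b0] S v False show ?thesis by auto
  qed
qed

text \<open>The coordinates of a common vector with respect to \<open>A \<union> B\<close> are
  supported in \<open>A\<close> and also in \<open>B\<close>, hence nowhere.\<close>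

lemma span_Int_independent_disjoint:
  assumes "independent (A \<union> B)" "A \<inter> B = {}"
  shows "span A \<inter> span B = {0}"
proof -
  have "x = 0" if x: "x \<in> span A" "x \<in> span B" for x
  proof -
    have A: "representation (A \<union> B) x = representation A x"
      by (rule representation_extend[OF assms(1) x(1)]) auto
    have B: "representation (A \<union> B) x = representation B x"
      by (rule representation_extend[OF assms(1) x(2)]) auto
    have "representation (A \<union> B) x b = 0" for b
      using A B assms(2) representation_ne_zero[of A x b] representation_ne_zero[of B x b]
      by (metis disjoint_iff)
    moreover have "x \<in> span (A \<union> B)"
      using x(1) span_mono[of A "A \<union> B"] by auto
    ultimately show "x = 0"
      using sum_nonzero_representation_eq[OF assms(1), of x] by simp
  qed
  then show ?thesis
    using span_zero by auto
qed

lemma complement_basis_exists: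
  assumes V: "subspace V" and U: "subspace U" and "V \<subseteq> U"
  obtains E where "complement_basis scale V U E"
proof -
  obtain C where C: "C \<subseteq> V" "independent C" "V \<subseteq> span C"
    using maximal_independent_subset[of V] by blast
  obtain D where D: "C \<subseteq> D" "D \<subseteq> U" "independent D" "U \<subseteq> span D"
    using maximal_independent_subset_extend[OF order_trans[OF C(1) \<open>V \<subseteq> U\<close>] C(2)] .
  have sC: "span C = V"
    by (rule span_subspace[OF C(1,3) V])
  have sD: "span D = U"
    by (rule span_subspace[OF D(2,4) U])
  have CD: "C \<union> (D - C) = D" using D by auto
  have "complement_basis scale V U (D - C)"
    unfolding complement_basis_def
  proof (intro conjI V)
    show "independent (D - C)" using D(3) by (rule independent_mono) auto
    show "V \<inter> span (D - C) = {0}"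
      using span_Int_independent_disjoint[of C "D - C"] D(3) CD sC by auto
    show "U = {v + e |v e. v \<in> V \<and> e \<in> span (D - C)}"
      using span_Un[of C "D - C"] CD sC sD by simp
  qed
  then show ?thesis by (rule that)
qed

text \<open>The projection along \<open>V\<close> is extended to a linear map on the whole type,
  with its values outside \<open>U\<close> left open. It serves to compare complements and, later,
  to define coefficient functionals.\<close>

lemma complement_basis_projection:
  assumes E: "complement_basis scale V U E"
  obtains p where "Vector_Spaces.linear scale scale p" "\<And>v. v \<in> V \<Longrightarrow> p v = 0" "\<And>e. e \<in> span E \<Longrightarrow> p e = e"
proof -
  interpret vector_space_pair scale scale ..
  obtain C where C: "C \<subseteq> V" "independent C" "V \<subseteq> span C"
    using maximal_independent_subset[of V] by blast
  have sC: "span C = V"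
    by (rule span_subspace[OF C(1,3) complement_basis_subset(4)[OF E]])
  have ind: "independent (C \<union> E)"
    using E C sC by (intro independent_Un_disjoint_spans) (auto simp: complement_basis_def)
  have disj: "c \<notin> E" if "c \<in> C" for c
  proof
    assume "c \<in> E"
    then have "c \<in> V \<inter> span E" using that C span_base by auto
    then have "c = 0" using E by (auto simp: complement_basis_def)
    then show False using that C dependent_zero by blast
  qed
  obtain p where p: "Vector_Spaces.linear scale scale p" "\<forall>x\<in>C \<union> E. p x = (if x \<in> C then 0 else x)"
    using linear_independent_extend[OF ind, of "\<lambda>x. if x \<in> C then 0 else x"] by blast
  interpret p: Vector_Spaces.linear scale scale p by (rule p(1))
  show ?thesis
  proof
    show "Vector_Spaces.linear scale scale p" by (rule p(1))
    show "p v = 0" if "v \<in> V" for v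
      using p.eq_0_on_span[of C v] p(2) that sC by auto
    show "p e = e" if "e \<in> span E" for e
    proof (rule linear_eq_on[OF p(1) _ that])
      show "Vector_Spaces.linear scale scale (\<lambda>x. x)" by (rule linear_ident)
      show "p b = b" if "b \<in> E" for b using that p(2) disj by auto
    qed
  qed
qed

end

text \<open>The equation for \<open>U'\<close> makes the induced map from \<open>U/V\<close> to
  \<open>U'/V'\<close> surjective, and the equation for \<open>V\<close> makes it well defined and
  injective; an isomorphism of quotients carries a basis to a basis.\<close>

lemma (in vector_space_pair) complement_basis_image:
  assumes f: "Vector_Spaces.linear s1 s2 f" and E: "complement_basis s1 V U E"
    and V': "vs2.subspace V'" and U': "U' = {f u + v |u v. u \<in> U \<and> v \<in> V'}"
    and V: "V = {u \<in> U. f u \<in> V'}"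
  shows "inj_on f E" "complement_basis s2 V' U' (f ` E)"
proof -
  interpret f: Vector_Spaces.linear s1 s2 f by (rule f)
  have E': "vs1.independent E" "V \<inter> vs1.span E = {0}" "U = {v + e |v e. v \<in> V \<and> e \<in> vs1.span E}"
    using E by (auto simp: complement_basis_def)
  have sE: "vs1.span E \<subseteq> U"
    using vs1.complement_basis_subset[OF E] by auto
  have key: "x = 0" if "x \<in> vs1.span E" "f x \<in> V'" for x
  proof -
    have "x \<in> V \<inter> vs1.span E" using that sE V by auto
    then show ?thesis using E'(2) by simp
  qed
  have inj: "inj_on f (vs1.span E)"
    unfolding f.inj_on_iff_eq_0[OF vs1.subspace_span]
    using key vs2.subspace_0[OF V'] by auto
  show "inj_on f E"
    by (rule inj_on_subset[OF inj vs1.span_superset])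
  show "complement_basis s2 V' U' (f ` E)"
    unfolding complement_basis_def
  proof (intro conjI V')
    show "vs2.independent (f ` E)"
      by (rule f.independent_injective_image[OF E'(1) inj])
    have "V' \<inter> vs2.span (f ` E) \<subseteq> {0}"
    proof
      fix y assume "y \<in> V' \<inter> vs2.span (f ` E)"
      then obtain x where "x \<in> vs1.span E" "f x \<in> V'" "y = f x"
        by (auto simp: f.span_image)
      then show "y \<in> {0}" using key[of x] f.zero by simp
    qed
    then show "V' \<inter> vs2.span (f ` E) = {0}"
      using vs2.subspace_0[OF V'] vs2.span_zero[of "f ` E"] by auto
    show "U' = {v + e |v e. v \<in> V' \<and> e \<in> vs2.span (f ` E)}"
    proof (intro set_eqI iffI)
      fix x assume "x \<in> U'"
      then obtain u w where x: "x = f u + w" "u \<in> U" "w \<in> V'" unfolding U' by auto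
      then obtain v e where u: "u = v + e" "v \<in> V" "e \<in> vs1.span E" using E'(3) by auto
      have "x = (f v + w) + f e" by (simp add: x u f.add)
      moreover have "f v + w \<in> V'" using u V x vs2.subspace_add[OF V'] by auto
      ultimately show "x \<in> {v + e |v e. v \<in> V' \<and> e \<in> vs2.span (f ` E)}"
        using u by (auto simp: f.span_image)
    next
      fix x assume "x \<in> {v + e |v e. v \<in> V' \<and> e \<in> vs2.span (f ` E)}"
      then obtain v e where "v \<in> V'" "e \<in> vs1.span E" "x = f e + v"
        by (auto simp: f.span_image add.commute)
      then show "x \<in> U'"
        unfolding U' using sE by blast
    qed
  qed
qed

context vector_space
begin

text \<open>The projection onto \<open>span E\<close> along \<open>V\<close> embeds
  \<open>U/V\<close> into \<open>span E\<close>, so it maps \<open>F\<close> injectively to an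
  independent set there, and the exchange bound applies.\<close>

lemma complement_basis_card_le:
  assumes E: "complement_basis scale V U E" "finite E" and F: "complement_basis scale V U F"
  shows "finite F \<and> card F \<le> card E"
proof -
  interpret vector_space_pair scale scale ..
  obtain p where p: "Vector_Spaces.linear scale scale p" "\<And>v. v \<in> V \<Longrightarrow> p v = 0" "\<And>e. e \<in> span E \<Longrightarrow> p e = e"
    using complement_basis_projection[OF E(1)] by blast
  interpret p: Vector_Spaces.linear scale scale p by (rule p(1))
  have U: "U = {v + e |v e. v \<in> V \<and> e \<in> span E}"
    using E by (auto simp: complement_basis_def)
  have pU: "p u \<in> span E" "p u = 0 \<longleftrightarrow> u \<in> V" if "u \<in> U" for u
  proof -
    have "u \<in> {v + e |v e. v \<in> V \<and> e \<in> span E}" using \<open>u \<in> U\<close> U by simp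
    then obtain v e where u: "u = v + e" "v \<in> V" "e \<in> span E" by blast
    have "p u = e" using u p by (simp add: p.add)
    then show "p u \<in> span E" using u by simp
    show "p u = 0 \<longleftrightarrow> u \<in> V"
    proof
      assume "p u = 0" then show "u \<in> V" using \<open>p u = e\<close> u by simp
    next
      assume "u \<in> V" then show "p u = 0" by (rule p(2))
    qed
  qed
  have V: "V = {u \<in> U. p u \<in> {0}}"
    using pU complement_basis_subset(1)[OF E(1)] by auto
  note im = complement_basis_image[OF p(1) F subspace_single_0 refl V]
  have "independent (p ` F)" using im(2) by (simp add: complement_basis_def)
  moreover have "p ` F \<subseteq> span E"
    using complement_basis_subset(3)[OF F] pU by auto
  ultimately have "finite (p ` F) \<and> card (p ` F) \<le> card E"
    by (rule independent_span_bound[OF E(2)])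
  then show ?thesis
    using im(1) by (simp add: card_image finite_image_iff)
qed

lemma rel_dim_subspaces:
  assumes "rel_dim scale V U d"
  shows "subspace V" "subspace U" "V \<subseteq> U"
proof -
  obtain E where "complement_basis scale V U E"
    using assms by (auto simp: rel_dim_def)
  then show "subspace V" "subspace U" "V \<subseteq> U"
    by (rule complement_basis_subset)+
qed

lemma rel_dim_complement_basis:
  assumes "rel_dim scale V U d" and F: "complement_basis scale V U F"
  shows "finite F \<and> card F = d"
proof -
  obtain E where E: "complement_basis scale V U E" "finite E" "card E = d"
    using assms by (auto simp: rel_dim_def)
  have F': "finite F" "card F \<le> card E"
    using complement_basis_card_le[OF E(1,2) F] by auto
  have "card E \<le> card F"
    using complement_basis_card_le[OF F F'(1) E(1)] by auto
  then show ?thesis using F' E by simp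
qed

lemma rel_dim_unique: "rel_dim scale V U a \<Longrightarrow> rel_dim scale V U b \<Longrightarrow> a = b"
  unfolding rel_dim_def[of _ _ _ b] using rel_dim_complement_basis by blast

lemma complement_basis_Un:
  assumes E: "complement_basis scale V U E" and F: "complement_basis scale U W F"
  shows "E \<inter> F = {}" "complement_basis scale V W (E \<union> F)"
proof -
  have E': "subspace V" "independent E" "V \<inter> span E = {0}" "U = {v + e |v e. v \<in> V \<and> e \<in> span E}"
    using E by (auto simp: complement_basis_def)
  have F': "independent F" "U \<inter> span F = {0}" "W = {v + e |v e. v \<in> U \<and> e \<in> span F}"
    using F by (auto simp: complement_basis_def)
  have sU: "span E \<subseteq> U" "V \<subseteq> U" "subspace U"
    using complement_basis_subset[OF E] by auto
  show "E \<inter> F = {}"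
  proof -
    have "x = 0" if "x \<in> E" "x \<in> F" for x
    proof -
      have "x \<in> U \<inter> span F" using that sU(1) span_base[of x] by auto
      then show ?thesis using F'(2) by auto
    qed
    then show ?thesis using E'(2) dependent_zero[of E] by blast
  qed
  have EF: "span E \<inter> span F = {0}"
  proof
    show "span E \<inter> span F \<subseteq> {0}" using sU(1) F'(2) by auto
  qed (simp add: span_zero)
  show "complement_basis scale V W (E \<union> F)"
    unfolding complement_basis_def
  proof (intro conjI E'(1))
    show "independent (E \<union> F)"
      by (rule independent_Un_disjoint_spans[OF E'(2) F'(1) EF])
    \<comment> \<open>The component in \<open>span F\<close> is a difference of elements of
      \<open>U\<close>, so it vanishes; what remains lies in
      \<open>V \<inter> span E\<close>.\<close>
    have "x = 0" if x: "x \<in> V" "x = e + f" "e \<in> span E" "f \<in> span F" for x e f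
    proof -
      have "f = x - e" using x by simp
      then have "f \<in> U" using x(1,3) sU subspace_diff[OF sU(3), of x e] by auto
      then have "f \<in> U \<inter> span F" using x(4) by simp
      then have "f = 0" using F'(2) by simp
      then have "x \<in> V \<inter> span E" using x by simp
      then show ?thesis using E'(3) by simp
    qed
    then have "V \<inter> span (E \<union> F) \<subseteq> {0}"
      by (auto simp: span_Un[of E F])
    then show "V \<inter> span (E \<union> F) = {0}"
      using subspace_0[OF E'(1)] span_zero[of "E \<union> F"] by auto
    show "W = {v + e |v e. v \<in> V \<and> e \<in> span (E \<union> F)}"
    proof -
      have "W = {(v + e) + f |v e f. v \<in> V \<and> e \<in> span E \<and> f \<in> span F}"
        unfolding F'(3) unfolding E'(4) by blast
      also have "\<dots> = {v + (e + f) |v e f. v \<in> V \<and> e \<in> span E \<and> f \<in> span F}"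
        by (simp only: add.assoc)
      also have "\<dots> = {v + e |v e. v \<in> V \<and> e \<in> span (E \<union> F)}"
        unfolding span_Un by blast
      finally show ?thesis .
    qed
  qed
qed

lemma rel_dim_trans:
  assumes "rel_dim scale V U a" "rel_dim scale U W b"
  shows "rel_dim scale V W (a + b)"
proof -
  obtain E F where E: "complement_basis scale V U E" "finite E" "card E = a"
    and F: "complement_basis scale U W F" "finite F" "card F = b"
    using assms unfolding rel_dim_def by auto
  have "card (E \<union> F) = a + b"
    using E F complement_basis_Un(1)[OF E(1) F(1)] by (simp add: card_Un_disjoint)
  then show ?thesis
    unfolding rel_dim_def using complement_basis_Un(2)[OF E(1) F(1)] E F by blast
qed

text \<open>The two complements are chosen without any finiteness; their union is a complement of
  \<open>V\<close> in \<open>W\<close>, and the finite dimension of \<open>W/V\<close> forces both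
  of them to be finite.\<close>

lemma rel_dim_split:
  assumes d: "rel_dim scale V W d" and U: "subspace U" "V \<subseteq> U" "U \<subseteq> W"
  obtains a b where "rel_dim scale V U a" "rel_dim scale U W b" "d = a + b"
proof -
  have VW: "subspace V" "subspace W"
    by (rule rel_dim_subspaces[OF d])+
  obtain E where E: "complement_basis scale V U E"
    using complement_basis_exists[OF VW(1) U(1,2)] .
  obtain F where F: "complement_basis scale U W F"
    using complement_basis_exists[OF U(1) VW(2) U(3)] .
  have fin: "finite (E \<union> F) \<and> card (E \<union> F) = d"
    by (rule rel_dim_complement_basis[OF d complement_basis_Un(2)[OF E F]])
  show ?thesis
  proof
    show "rel_dim scale V U (card E)" "rel_dim scale U W (card F)"
      using E F fin by (auto simp: rel_dim_def)
    show "d = card E + card F"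
      using fin complement_basis_Un(1)[OF E F] by (auto simp: card_Un_disjoint)
  qed
qed

end

text \<open>Special choices recover the isomorphism theorems: the identity relates
  \<open>U / (U \<inter> V')\<close> to \<open>(U + V') / V'\<close>, and \<open>V' = {0}\<close>
  relates \<open>U\<close> modulo the kernel to its image. As \<open>f\<close> maps a complement
  basis bijectively to one, finiteness on either side passes to the other.\<close>

lemma (in vector_space_pair) rel_dim_iso:
  assumes f: "Vector_Spaces.linear s1 s2 f" and U: "vs1.subspace U"
    and V': "vs2.subspace V'" and U': "U' = {f u + v |u v. u \<in> U \<and> v \<in> V'}"
    and V: "V = {u \<in> U. f u \<in> V'}"
  shows "rel_dim s1 V U d \<longleftrightarrow> rel_dim s2 V' U' d"
proof -
  have sV: "vs1.subspace V"
    unfolding V using vs1.subspace_inter[OF U linear_subspace_linear_preimage[OF f V']]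
    by (simp add: Int_def)
  have "V \<subseteq> U" using V by auto
  then obtain E where E: "complement_basis s1 V U E"
    using vs1.complement_basis_exists[OF sV U] by blast
  note im = complement_basis_image[OF f E V' U' V]
  have card: "card (f ` E) = card E" "finite (f ` E) = finite E"
    using im(1) by (simp_all add: card_image finite_image_iff)
  show ?thesis
  proof
    assume "rel_dim s1 V U d"
    then have "finite E \<and> card E = d" by (rule vs1.rel_dim_complement_basis[OF _ E])
    then show "rel_dim s2 V' U' d" using im(2) card by (auto simp: rel_dim_def)
  next
    assume "rel_dim s2 V' U' d"
    then have "finite (f ` E) \<and> card (f ` E) = d" by (rule vs2.rel_dim_complement_basis[OF _ im(2)])
    then show "rel_dim s1 V U d" using E card by (auto simp: rel_dim_def)
  qed
qed

section \<open>Relative dimension in terms of \<open>codim\<close>, \<open>finite_codim\<close>,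
  \<open>dim\<close> and \<open>finite_dim\<close>\<close>

context vector_space
begin

lemma quotient_basis_iff_complement_basis:
  assumes X: "scl X = scale" and U: "subspace (carrier X)" and V: "subspace V" "V \<subseteq> carrier X"
  shows "quotient_basis X V B \<longleftrightarrow> finite B \<and> complement_basis scale V (carrier X) B"
proof (intro iffI conjI)
  assume qb: "quotient_basis X V B"
  show fin: "finite B" using qb by (simp add: quotient_basis_def)
  have BX: "B \<subseteq> carrier X" using qb by (simp add: quotient_basis_def)
  have ex1: "\<exists>!c. (\<forall>b. b \<notin> B \<longrightarrow> c b = 0) \<and> x - (\<Sum>b\<in>B. scale (c b) b) \<in> V"
    if "x \<in> carrier X" for x
    using qb that X by (simp add: quotient_basis_def)
  \<comment> \<open>Uniqueness is applied to the coefficients of the vector 0: a combination lying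
    in \<open>V\<close> competes with the zero combination. This yields both the independence of
    \<open>B\<close> and \<open>V \<inter> span B = {0}\<close>.\<close>
  have zero: "u b = 0" if u: "(\<Sum>b\<in>B. scale (u b) b) \<in> V" and b: "b \<in> B" for u b
  proof -
    define P where
      "P = (\<lambda>c. (\<forall>b. b \<notin> B \<longrightarrow> c b = 0) \<and> 0 - (\<Sum>b\<in>B. scale (c b) b) \<in> V)"
    let ?c = "\<lambda>b. if b \<in> B then u b else 0"
    have "(\<Sum>b\<in>B. scale (?c b) b) = (\<Sum>b\<in>B. scale (u b) b)"
      by (rule sum.cong) auto
    then have 1: "P ?c"
      using subspace_diff[OF V(1) subspace_0[OF V(1)] u] by (simp add: P_def)
    have 2: "P (\<lambda>b. 0)"
      using subspace_0[OF V(1)] by (simp add: P_def)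
    have "\<exists>!c. P c"
      using ex1[OF subspace_0[OF U]] by (simp only: P_def)
    then obtain c0 where c0: "\<And>c. P c \<Longrightarrow> c = c0" by metis
    have "?c b = 0" using fun_cong[OF trans[OF c0[OF 1] c0[OF 2, symmetric]], of b] .
    then show ?thesis using b by simp
  qed
  show "complement_basis scale V (carrier X) B"
    unfolding complement_basis_def
  proof (intro conjI V)
    show "independent B"
      by (rule independent_if_scalars_zero[OF fin]) (use zero subspace_0[OF V(1)] in auto)
    have "x = 0" if x: "x \<in> V" "x \<in> span B" for x
    proof -
      obtain u where "x = (\<Sum>b\<in>B. scale (u b) b)"
        using x(2) unfolding span_finite[OF fin] by auto
      then show ?thesis using zero[of u] x(1) by simp
    qed
    then show "V \<inter> span B = {0}"
      using subspace_0[OF V(1)] span_zero by auto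
    show "carrier X = {v + e |v e. v \<in> V \<and> e \<in> span B}"
    proof (intro equalityI subsetI)
      fix x assume "x \<in> carrier X"
      then obtain c where "x - (\<Sum>b\<in>B. scale (c b) b) \<in> V" using ex1 by blast
      moreover have "(\<Sum>b\<in>B. scale (c b) b) \<in> span B"
        by (intro span_sum span_scale span_base)
      moreover have "x = (x - (\<Sum>b\<in>B. scale (c b) b)) + (\<Sum>b\<in>B. scale (c b) b)" by simp
      ultimately show "x \<in> {v + e |v e. v \<in> V \<and> e \<in> span B}" by blast
    next
      fix x assume "x \<in> {v + e |v e. v \<in> V \<and> e \<in> span B}"
      then show "x \<in> carrier X"
        using V(2) span_minimal[OF BX U] subspace_add[OF U] by blast
    qed
  qed
next
  assume "finite B \<and> complement_basis scale V (carrier X) B"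
  then have fin: "finite B" and cb: "complement_basis scale V (carrier X) B" by auto
  then have ind: "independent B" and VB: "V \<inter> span B = {0}"
    and XX: "carrier X = {v + e |v e. v \<in> V \<and> e \<in> span B}"
    by (simp_all add: complement_basis_def)
  show "quotient_basis X V B"
    unfolding quotient_basis_def X
  proof (intro conjI ballI fin)
    show "B \<subseteq> carrier X" by (rule complement_basis_subset[OF cb])
    fix x assume "x \<in> carrier X"
    then have "x \<in> {v + e |v e. v \<in> V \<and> e \<in> span B}" using XX by simp
    then obtain v e where x: "x = v + e" "v \<in> V" "e \<in> span B" by blast
    obtain u where u: "e = (\<Sum>b\<in>B. scale (u b) b)"
      using x(3) unfolding span_finite[OF fin] by auto
    show "\<exists>!c. (\<forall>b. b \<notin> B \<longrightarrow> c b = 0) \<and> x - (\<Sum>b\<in>B. scale (c b) b) \<in> V"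
    proof (intro ex1I conjI)
      let ?c = "\<lambda>b. if b \<in> B then u b else 0"
      have sc: "(\<Sum>b\<in>B. scale (?c b) b) = e"
        unfolding u by (rule sum.cong) auto
      show "\<forall>b. b \<notin> B \<longrightarrow> ?c b = 0" by simp
      show "x - (\<Sum>b\<in>B. scale (?c b) b) \<in> V" using sc x by simp
      fix c assume c: "(\<forall>b. b \<notin> B \<longrightarrow> c b = 0) \<and> x - (\<Sum>b\<in>B. scale (c b) b) \<in> V"
      have "(\<Sum>b\<in>B. scale (?c b - c b) b) = (x - (\<Sum>b\<in>B. scale (c b) b)) - v"
        using sc x(1) by (simp add: scale_left_diff_distrib sum_subtractf)
      also have "\<dots> \<in> V" using c x(2) subspace_diff[OF V(1)] by blast
      finally have "(\<Sum>b\<in>B. scale (?c b - c b) b) \<in> V" .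
      moreover have "(\<Sum>b\<in>B. scale (?c b - c b) b) \<in> span B"
        by (intro span_sum span_scale span_base)
      ultimately have "(\<Sum>b\<in>B. scale (?c b - c b) b) = 0" using VB by blast
      then have "\<And>b. b \<in> B \<Longrightarrow> ?c b - c b = 0"
        by (rule independentD[OF ind fin subset_refl])
      then show "c = ?c" using c by (auto simp: fun_eq_iff)
    qed
  qed
qed

text \<open>\<open>codim\<close> takes the cardinality of a quotient basis selected by choice;
  uniqueness of relative dimension makes the value independent of the selection.\<close>

lemma rel_dim_codim:
  assumes X: "scl X = scale" and U: "subspace (carrier X)" and V: "subspace V" "V \<subseteq> carrier X"
  shows "rel_dim scale V (carrier X) d \<longleftrightarrow> finite_codim X V \<and> codim X V = d"
proof -
  note iff = quotient_basis_iff_complement_basis[OF assms]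
  have *: "rel_dim scale V (carrier X) (codim X V)" if "finite_codim X V"
  proof -
    have "quotient_basis X V (SOME B. quotient_basis X V B)"
      using that unfolding finite_codim_def by (rule someI_ex)
    then show ?thesis
      unfolding rel_dim_def codim_def iff by blast
  qed
  show ?thesis
  proof
    assume d: "rel_dim scale V (carrier X) d"
    then have "finite_codim X V"
      unfolding finite_codim_def rel_dim_def iff by blast
    with * d rel_dim_unique show "finite_codim X V \<and> codim X V = d" by blast
  next
    assume "finite_codim X V \<and> codim X V = d"
    with * show "rel_dim scale V (carrier X) d" by blast
  qed
qed

text \<open>A complement basis of \<open>{0}\<close> in \<open>V\<close> is just a basis of
  \<open>V\<close>; the finite spanning set in \<open>finite_dim\<close> bounds its size.\<close>

lemma rel_dim_zero_iff:
  assumes X: "scl X = scale" and V: "subspace V"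
  shows "rel_dim scale {0} V d \<longleftrightarrow> finite_dim X V \<and> dim V = d"
proof
  assume "rel_dim scale {0} V d"
  then obtain E where E: "complement_basis scale {0} V E" "finite E" "card E = d"
    by (auto simp: rel_dim_def)
  then have "independent E" "V = span E"
    by (auto simp: complement_basis_def)
  then show "finite_dim X V \<and> dim V = d"
    unfolding finite_dim_def X using E dim_span_eq_card_independent span_superset by blast
next
  assume fd: "finite_dim X V \<and> dim V = d"
  then obtain B where B: "finite B" "V \<subseteq> span B"
    unfolding finite_dim_def X by auto
  obtain E where E: "E \<subseteq> V" "independent E" "V \<subseteq> span E" "card E = dim V"
    using basis_exists[of V] by blast
  have "finite E"
    using independent_span_bound[OF B(1) E(2)] E(1) B(2) by auto
  moreover have "span E = V" by (rule span_subspace[OF E(1,3) V])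
  ultimately show "rel_dim scale {0} V d"
    unfolding rel_dim_def complement_basis_def using E fd span_zero
    by (intro exI[of _ E]) auto
qed

end

section \<open>Index counts for restricting the domain and enlarging the range\<close>

context vector_space_pair
begin

text \<open>With \<open>K\<close> and \<open>K'\<close> the kernels on \<open>X\<close> and
  \<open>X'\<close>, put \<open>M = K' + X\<close> and split \<open>n\<close> along
  \<open>X \<subseteq> M \<subseteq> X'\<close>. The quotient \<open>M/X\<close> is isomorphic to
  \<open>K'/K\<close> and measures the loss of kernel; \<open>f\<close> carries \<open>X'/M\<close>
  isomorphically to \<open>f X' / f X\<close>, which measures the loss of range.\<close>

lemma rel_dim_restrict_domain:
  assumes f: "Vector_Spaces.linear s1 s2 f" and n: "rel_dim s1 X X' n"
    and k: "rel_dim s1 {0} {x \<in> X'. f x = 0} k" and c: "rel_dim s2 (f ` X') W c"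
  obtains k1 c1 where "rel_dim s1 {0} {x \<in> X. f x = 0} k1" "rel_dim s2 (f ` X) W c1"
    "k1 + n + c = k + c1"
proof -
  interpret f: Vector_Spaces.linear s1 s2 f by (rule f)
  interpret s11: vector_space_pair s1 s1 ..
  note X = vs1.rel_dim_subspaces[OF n]
  let ?K = "{x \<in> X. f x = 0}" and ?K' = "{x \<in> X'. f x = 0}"
  let ?M = "{u + v |u v. u \<in> ?K' \<and> v \<in> X}"
  have K': "vs1.subspace ?K'" using vs1.rel_dim_subspaces[OF k] by simp
  have K: "vs1.subspace ?K"
    using vs1.subspace_inter[OF X(1) f.subspace_kernel] by (simp add: Int_def)
  have M: "vs1.subspace ?M" by (rule vs1.subspace_sums[OF K' X(1)])
  have "X \<subseteq> ?M" using vs1.subspace_0[OF X(2)] f.zero by force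
  moreover have "?M \<subseteq> X'" using X(3) vs1.subspace_add[OF X(2)] by auto
  ultimately obtain a b where ab: "rel_dim s1 X ?M a" "rel_dim s1 ?M X' b" "n = a + b"
    using vs1.rel_dim_split[OF n M] by blast
  have "?K = {u \<in> ?K'. u \<in> X}" using X(3) by auto
  from s11.rel_dim_iso[OF vs1.linear_ident K' X(1) refl this]
  have KK': "rel_dim s1 ?K ?K' a"
    using ab(1) by blast
  have sub: "vs2.subspace (f ` X)" by (rule f.subspace_image[OF X(1)])
  have img: "f ` X' = {f u + v |u v. u \<in> X' \<and> v \<in> f ` X}"
  proof (intro equalityI subsetI)
    fix y assume "y \<in> f ` X'"
    then obtain u where "u \<in> X'" "y = f u + f 0" by (auto simp: f.zero)
    then show "y \<in> {f u + v |u v. u \<in> X' \<and> v \<in> f ` X}"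
      using vs1.subspace_0[OF X(1)] by blast
  next
    fix y assume "y \<in> {f u + v |u v. u \<in> X' \<and> v \<in> f ` X}"
    then obtain u v where "u \<in> X'" "v \<in> X" "y = f (u + v)" by (auto simp: f.add)
    then show "y \<in> f ` X'" using X(3) vs1.subspace_add[OF X(2)] by blast
  qed
  have preimg: "?M = {u \<in> X'. f u \<in> f ` X}"
  proof (intro equalityI subsetI)
    fix x assume "x \<in> ?M"
    then obtain u v where "u \<in> X'" "f u = 0" "v \<in> X" "x = u + v" by auto
    then show "x \<in> {u \<in> X'. f u \<in> f ` X}"
      using X(3) vs1.subspace_add[OF X(2)] by (auto simp: f.add)
  next
    fix x assume "x \<in> {u \<in> X'. f u \<in> f ` X}"
    then obtain v where "x \<in> X'" "v \<in> X" "f x = f v" by auto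
    then have "x - v \<in> ?K'" "v \<in> X" "x = (x - v) + v"
      using X(3) vs1.subspace_diff[OF X(2)] by (auto simp: f.diff)
    then show "x \<in> ?M" by blast
  qed
  have b: "rel_dim s2 (f ` X) (f ` X') b"
    by (rule iffD1[OF rel_dim_iso[OF f X(2) sub img preimg] ab(2)])
  have "?K \<subseteq> ?K'" "{0} \<subseteq> ?K" using X(3) vs1.subspace_0[OF X(1)] f.zero by auto
  then obtain k1 a' where k1: "rel_dim s1 {0} ?K k1" "rel_dim s1 ?K ?K' a'" "k = k1 + a'"
    using vs1.rel_dim_split[OF k K] by blast
  have "a' = a" using vs1.rel_dim_unique[OF k1(2) KK'] .
  then show ?thesis
    using that[OF k1(1) vs2.rel_dim_trans[OF b c]] k1(3) ab(3) by simp
qed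

text \<open>This is the effect of following \<open>f\<close> by the quotient map modulo
  \<open>L\<close>. Split \<open>n\<close> along \<open>L \<inter> f X \<subseteq> L\<close>: the
  lower part is the growth of the kernel, because \<open>f\<close> maps the preimage of
  \<open>L\<close> onto \<open>L \<inter> f X\<close>; the upper part is the drop of the
  codimension, because \<open>(L + f X) / f X\<close> is isomorphic to
  \<open>L / (L \<inter> f X)\<close>.\<close>

lemma rel_dim_enlarge_range:
  assumes f: "Vector_Spaces.linear s1 s2 f" and X: "vs1.subspace X"
    and n: "rel_dim s2 {0} L n" and LW: "L \<subseteq> W"
    and k: "rel_dim s1 {0} {x \<in> X. f x = 0} k" and c: "rel_dim s2 (f ` X) W c"
  obtains k2 c2 where "rel_dim s1 {0} {x \<in> X. f x \<in> L} k2"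
    "rel_dim s2 {l + w |l w. l \<in> L \<and> w \<in> f ` X} W c2" "k2 + c = k + n + c2"
proof -
  interpret f: Vector_Spaces.linear s1 s2 f by (rule f)
  interpret s22: vector_space_pair s2 s2 ..
  note L = vs2.rel_dim_subspaces(2)[OF n]
  note fX = vs2.rel_dim_subspaces[OF c]
  let ?K = "{x \<in> X. f x = 0}" and ?K2 = "{x \<in> X. f x \<in> L}"
  let ?I = "{u \<in> L. u \<in> f ` X}" and ?R = "{l + w |l w. l \<in> L \<and> w \<in> f ` X}"
  have I: "vs2.subspace ?I"
    using vs2.subspace_inter[OF L fX(1)] by (simp add: Int_def)
  have R: "vs2.subspace ?R" by (rule vs2.subspace_sums[OF L fX(1)])
  have K2: "vs1.subspace ?K2"
    using vs1.subspace_inter[OF X f.subspace_linear_preimage[OF L]] by (simp add: Int_def)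
  have "{0} \<subseteq> ?I" "?I \<subseteq> L" using vs2.subspace_0[OF I] by auto
  then obtain a b where ab: "rel_dim s2 {0} ?I a" "rel_dim s2 ?I L b" "n = a + b"
    using vs2.rel_dim_split[OF n I] by blast
  have b: "rel_dim s2 (f ` X) ?R b"
    by (rule iffD1[OF s22.rel_dim_iso[OF vs2.linear_ident L fX(1) refl refl] ab(2)])
  have img: "?I = {f u + v |u v. u \<in> ?K2 \<and> v \<in> {0}}" by auto
  have preimg: "?K = {u \<in> ?K2. f u \<in> {0}}" using vs2.subspace_0[OF L] by auto
  have "rel_dim s1 ?K ?K2 a"
    by (rule iffD2[OF rel_dim_iso[OF f K2 vs2.subspace_single_0 img preimg] ab(1)])
  then have k2: "rel_dim s1 {0} ?K2 (k + a)" by (rule vs1.rel_dim_trans[OF k])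
  have "f ` X \<subseteq> ?R" using vs2.subspace_0[OF L] by force
  moreover have "?R \<subseteq> W" using LW fX(3) vs2.subspace_add[OF fX(2)] by auto
  ultimately obtain b' c2 where c2: "rel_dim s2 (f ` X) ?R b'" "rel_dim s2 ?R W c2" "c = b' + c2"
    using vs2.rel_dim_split[OF c R] by blast
  have "b' = b" using vs2.rel_dim_unique[OF c2(1) b] .
  then show ?thesis
    using that[OF k2 c2(2)] c2(3) ab(3) by simp
qed

lemma rel_dim_compression:
  assumes f: "Vector_Spaces.linear s1 s2 f" and n: "rel_dim s1 X X' n"
    and L: "rel_dim s2 {0} L n" "L \<subseteq> W"
    and k: "rel_dim s1 {0} {x \<in> X'. f x = 0} k" and c: "rel_dim s2 (f ` X') W c"
  obtains k2 c2 where "rel_dim s1 {0} {x \<in> X. f x \<in> L} k2"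
    "rel_dim s2 {l + w |l w. l \<in> L \<and> w \<in> f ` X} W c2" "k2 + c = k + c2"
proof -
  obtain k1 c1 where 1: "rel_dim s1 {0} {x \<in> X. f x = 0} k1" "rel_dim s2 (f ` X) W c1"
    "k1 + n + c = k + c1"
    using rel_dim_restrict_domain[OF f n k c] .
  obtain k2 c2 where 2: "rel_dim s1 {0} {x \<in> X. f x \<in> L} k2"
    "rel_dim s2 {l + w |l w. l \<in> L \<and> w \<in> f ` X} W c2" "k2 + c1 = k1 + n + c2"
    using rel_dim_enlarge_range[OF f vs1.rel_dim_subspaces(1)[OF n] L 1(1,2)] .
  show ?thesis
    using that[OF 2(1,2)] 1(3) 2(3) by simp
qed

end

section \<open>Closed subspaces and finite-dimensional extensions\<close>

text \<open>\<open>d\<close> is the radius of a ball around \<open>b\<close> that misses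
  \<open>V\<close>. Dividing by \<open>c\<close> puts \<open>b - x/c\<close> into \<open>V\<close>,
  and this point has distance at least \<open>d\<close> from \<open>b\<close>. The continuity of all
  coefficient functionals comes from this estimate.\<close>

lemma (in banach_space_over) separation_from_closed:
  assumes V: "subspace V" "closed V" and b: "b \<notin> V"
  obtains d where "d > 0" "\<And>c x. x - sc c b \<in> V \<Longrightarrow> norm c * d \<le> norm x"
proof -
  obtain d where d: "d > 0" "ball b d \<subseteq> - V"
    using V(2) b open_contains_ball[of "- V"] by (auto simp: open_Compl)
  have "norm c * d \<le> norm x" if x: "x - sc c b \<in> V" for c x
  proof (cases "c = 0")
    case False
    have "- sc (inverse c) (x - sc c b) \<in> V"
      by (rule subspace_neg[OF V(1) subspace_scale[OF V(1) x]])
    moreover have "- sc (inverse c) (x - sc c b) = b - sc (inverse c) x"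
      using False by (simp add: scale_right_diff_distrib)
    ultimately have V': "b - sc (inverse c) x \<in> V"
      by (simp only:)
    have "\<not> dist b (b - sc (inverse c) x) < d"
      using V' subsetD[OF d(2), of "b - sc (inverse c) x"] unfolding mem_ball by auto
    then have "d \<le> norm (sc (inverse c) x)"
      by (simp add: dist_norm)
    then have "d \<le> norm x / norm c"
      by (simp add: norm_scale norm_inverse divide_inverse mult.commute)
    then show ?thesis
      using False by (simp add: le_divide_eq mult.commute)
  qed simp
  then show ?thesis using that d by blast
qed

text \<open>By separation the coefficients of \<open>b\<close> along a convergent sequence are
  Cauchy; they converge because the scalar field is complete, and subtracting their multiples of
  \<open>b\<close> leaves a convergent sequence in \<open>V\<close>.\<close>

lemma (in banach_space_over) closed_span_insert:
  assumes V: "subspace V" "closed V"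
  shows "closed (span (insert b V))"
proof (cases "b \<in> V")
  case True
  then show ?thesis
    using V(2) by (simp only: insert_absorb span_eq_iff[THEN iffD2, OF V(1)])
next
  case False
  obtain d where d: "d > 0" "\<And>c x. x - sc c b \<in> V \<Longrightarrow> norm c * d \<le> norm x"
    using separation_from_closed[OF V False] by blast
  have sV: "span V = V" by (rule span_eq_iff[THEN iffD2, OF V(1)])
  show ?thesis
    unfolding closed_sequential_limits
  proof (intro allI impI)
    fix f l assume fl: "(\<forall>n. f n \<in> span (insert b V)) \<and> f \<longlonglongrightarrow> l"
    then have "\<forall>n. \<exists>k. f n - sc k b \<in> V"
      by (auto simp: span_insert sV)
    then obtain k where k: "\<And>n. f n - sc (k n) b \<in> V" by metis
    have diff: "norm (k m - k n) * d \<le> norm (f m - f n)" for m n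
    proof (rule d(2))
      have "(f m - sc (k m) b) - (f n - sc (k n) b) \<in> V"
        by (rule subspace_diff[OF V(1) k k])
      then show "f m - f n - sc (k m - k n) b \<in> V"
        by (simp add: scale_left_diff_distrib algebra_simps)
    qed
    have "Cauchy f" using fl LIMSEQ_imp_Cauchy by blast
    have "Cauchy k"
    proof (rule metric_CauchyI)
      fix e :: real assume "e > 0"
      then have "e * d > 0" using d by simp
      then obtain M where M: "\<And>m n. m \<ge> M \<Longrightarrow> n \<ge> M \<Longrightarrow> dist (f m) (f n) < e * d"
        using metric_CauchyD[OF \<open>Cauchy f\<close>] by blast
      have "dist (k m) (k n) < e" if "m \<ge> M" "n \<ge> M" for m n
      proof -
        have "norm (k m - k n) * d < e * d"
          using diff[of m n] M[OF that] by (simp add: dist_norm)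
        then show ?thesis using d by (simp add: dist_norm)
      qed
      then show "\<exists>M. \<forall>m\<ge>M. \<forall>n\<ge>M. dist (k m) (k n) < e" by blast
    qed
    then obtain c where c: "k \<longlonglongrightarrow> c"
      using Cauchy_convergent_iff convergent_def by blast
    have "(\<lambda>n. sc (k n) b) \<longlonglongrightarrow> sc c b"
    proof (rule LIM_zero_cancel, rule tendsto_norm_zero_cancel)
      have "(\<lambda>n. norm (k n - c) * norm b) \<longlonglongrightarrow> 0 * norm b"
        by (intro tendsto_mult tendsto_const tendsto_norm_zero LIM_zero c)
      then show "(\<lambda>n. norm (sc (k n) b - sc c b)) \<longlonglongrightarrow> 0"
        by (simp add: scale_left_diff_distrib[symmetric] norm_scale)
    qed
    then have "(\<lambda>n. f n - sc (k n) b) \<longlonglongrightarrow> l - sc c b"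
      using fl by (intro tendsto_diff) auto
    then have "l - sc c b \<in> V"
      by (rule closed_sequentially[OF V(2) k])
    then show "l \<in> span (insert b V)"
      by (auto simp: span_insert sV)
  qed
qed

lemma (in banach_space_over) closed_span_Un_finite:
  assumes V: "subspace V" "closed V" and B: "finite B"
  shows "closed (span (B \<union> V))"
  using B
proof induction
  case empty
  show ?case using V(2) by (simp only: Un_empty_left span_eq_iff[THEN iffD2, OF V(1)])
next
  case (insert b B)
  have "span (insert b B \<union> V) = span (insert b (span (B \<union> V)))"
    by (simp add: span_insert span_span)
  then show ?case
    using closed_span_insert[OF subspace_span insert.IH] by simp
qed

text \<open>The map \<open>r \<mapsto> sc (of_real r) x - r *\<^sub>R x\<close> is additive, \<open>1\<close>-periodic and at most
  \<open>2 * \<bar>r\<bar> * norm x\<close> in norm; hence it is bounded, and an additive bounded map vanishes.\<close>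

lemma (in banach_space_over) scale_of_real: "sc (of_real r) x = r *\<^sub>R x"
proof -
  define g where "g r = sc (of_real r) x - r *\<^sub>R x" for r :: real
  have add: "g (r + s) = g r + g s" for r s
    by (simp add: g_def scale_left_distrib algebra_simps)
  have g1: "g 1 = 0" by (simp add: g_def)
  have nat: "g (real n * r) = real n *\<^sub>R g r" for n r
  proof (induction n)
    case 0
    then show ?case by (simp add: g_def)
  next
    case (Suc n)
    have "g (real (Suc n) * r) = g (real n * r + r)" by (simp add: algebra_simps)
    then show ?case using Suc add by (simp add: algebra_simps)
  qed
  have neg: "g (- r) = - g r" for r
    by (simp add: g_def)
  have int: "g (of_int n) = 0" for n :: int
  proof (cases n)
    case (nonneg m) then show ?thesis using nat[of m 1] g1 by simp
  next
    case (neg m) then show ?thesis using nat[of "Suc m" 1] g1 \<open>\<And>r. g (- r) = - g r\<close>[of "real (Suc m)"]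
      by simp
  qed
  have bd: "norm (g r) \<le> 2 * norm x" for r
  proof -
    have "g r = g (of_int \<lfloor>r\<rfloor> + frac r)" by (simp add: frac_def)
    also have "\<dots> = g (frac r)" using add int by simp
    also have "norm \<dots> \<le> norm (sc (of_real (frac r)) x) + norm (frac r *\<^sub>R x)"
      unfolding g_def by (rule norm_triangle_ineq4)
    also have "\<dots> = 2 * (frac r * norm x)" by (simp add: norm_scale)
    also have "\<dots> \<le> 2 * norm x"
      using mult_right_mono[of "frac r" 1 "norm x"] frac_lt_1[of r] by simp
    finally show ?thesis by simp
  qed
  have "norm (g r) = 0"
  proof (rule ccontr)
    assume "norm (g r) \<noteq> 0"
    then obtain n where "2 * norm x < real n * norm (g r)"
      using reals_Archimedean3[of "norm (g r)"] by auto
    then show False using bd[of "real n * r"] nat[of n r] by simp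
  qed
  then show ?thesis by (simp add: g_def)
qed

section \<open>Bounded preimages\<close>

text \<open>Baire category in the closed range, which is completely metrizable: the closures of the
  images of balls cover it, so one of them contains a relatively open piece. Passing to closures is
  what limits the conclusion to approximation.\<close>

lemma approximate_preimages:
  fixes T :: "'a::banach \<Rightarrow> 'b::banach"
  assumes T: "bounded_linear T" and cl: "closed (range T)"
  obtains M where "M > 0"
    "\<And>w \<epsilon>. w \<in> range T \<Longrightarrow> \<epsilon> > 0 \<Longrightarrow> \<exists>x. norm x \<le> M * norm w \<and> norm (w - T x) < \<epsilon>"
proof -
  interpret T: bounded_linear T by (rule T)
  let ?R = "range T"
  have sR: "subspace ?R" by (rule linear_subspace_image[OF T.linear_axioms subspace_UNIV])
  let ?X = "top_of_set ?R"
  define C where "C n = closure (T ` ball 0 (real n)) \<inter> ?R" for n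
  have clC: "closedin ?X (C n)" for n
    unfolding C_def by (simp add: closedin_closed_Int inf_commute)
  have cover: "?R \<subseteq> \<Union>(range C)"
  proof
    fix w assume "w \<in> ?R"
    then obtain x where "w = T x" by auto
    moreover obtain n where "norm x < real n" using reals_Archimedean2 by blast
    ultimately have "w \<in> T ` ball 0 (real n)" by auto
    then have "w \<in> C n"
      using subsetD[OF closure_subset, of w "T ` ball 0 (real n)"] \<open>w \<in> ?R\<close> unfolding C_def by blast
    then show "w \<in> \<Union>(range C)" by auto
  qed
  have "\<exists>n. ?X interior_of C n \<noteq> {}"
  proof (rule ccontr)
    assume "\<nexists>n. ?X interior_of C n \<noteq> {}"
    then have "?X interior_of \<Union>(range C) = {}"
      using clC completely_metrizable_space_closedin[of euclidean ?R] cl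
      by (intro Baire_category_alt disjI1)
         (auto simp: completely_metrizable_space_euclidean)
    moreover have "?X interior_of \<Union>(range C) = ?R"
    proof -
      have "\<Union>(range C) = ?R" using cover by (auto simp: C_def)
      then show ?thesis using interior_of_topspace[of ?X] by simp
    qed
    ultimately show False by auto
  qed
  then obtain n w0 where w0: "w0 \<in> ?X interior_of C n" by blast
  have "openin ?X (?X interior_of C n)" by (rule openin_interior_of)
  then obtain Q where Q: "open Q" "?X interior_of C n = ?R \<inter> Q"
    unfolding openin_open by blast
  then obtain e where e: "e > 0" "ball w0 e \<subseteq> Q"
    using w0 open_contains_ball[of Q] by blast
  have w0R: "w0 \<in> ?R" using w0 Q by blast
  have inC: "w \<in> closure (T ` ball 0 (real n))" if "w \<in> ?R" "dist w0 w < e" for w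
  proof -
    have "w \<in> Q" using that(2) subsetD[OF e(2), of w] by simp
    then have "w \<in> ?X interior_of C n" using that(1) Q(2) by simp
    then have "w \<in> C n" by (rule subsetD[OF interior_of_subset])
    then show ?thesis by (simp add: C_def)
  qed
  \<comment> \<open>Subtracting approximate preimages of \<open>w0\<close> and \<open>w0 + w\<close>
    moves the center from \<open>w0\<close> to 0 and doubles the radius
    \<open>real n\<close>.\<close>
  have small: "\<exists>x. norm x \<le> 2 * real n \<and> norm (w - T x) < \<epsilon>"
    if w: "w \<in> ?R" "norm w < e" and "\<epsilon> > 0" for w \<epsilon>
  proof -
    have "w0 + w \<in> closure (T ` ball 0 (real n))" "w0 \<in> closure (T ` ball 0 (real n))"
      using inC[of "w0 + w"] inC[of w0] subspace_add[OF sR w0R w(1)] w w0R e(1)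
      by (simp_all add: dist_norm)
    then obtain y z where y: "y \<in> T ` ball 0 (real n)" "dist y (w0 + w) < \<epsilon> / 2"
      and z: "z \<in> T ` ball 0 (real n)" "dist z w0 < \<epsilon> / 2"
      using half_gt_zero[OF \<open>\<epsilon> > 0\<close>] unfolding closure_approachable by blast
    obtain a where a: "y = T a" "norm a < real n" using y by auto
    obtain b where b: "z = T b" "norm b < real n" using z by auto
    have wT: "w - T (a - b) = (w0 + w - y) - (w0 - z)"
      by (simp add: a b T.diff)
    have "norm (w - T (a - b)) \<le> dist y (w0 + w) + dist z w0"
      unfolding wT using norm_triangle_ineq4[of "w0 + w - y" "w0 - z"]
      by (simp only: dist_norm norm_minus_commute)
    then have "norm (w - T (a - b)) < \<epsilon>" using y z by simp
    moreover have "norm (a - b) \<le> 2 * real n"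
      using norm_triangle_ineq4[of a b] a b by simp
    ultimately show ?thesis by blast
  qed
  \<comment> \<open>Rescaling \<open>w\<close> to norm \<open>e / 2\<close> turns the bound
    \<open>2 * real n\<close> into \<open>4 * real n / e\<close> per unit of norm; the added 1 keeps
    \<open>M\<close> positive when \<open>n = 0\<close>.\<close>
  define M where "M = (4 * real n + 1) / e"
  show ?thesis
  proof
    show "M > 0" using e by (simp add: M_def)
    fix w and \<epsilon> :: real assume w: "w \<in> ?R" and eps: "\<epsilon> > 0"
    show "\<exists>x. norm x \<le> M * norm w \<and> norm (w - T x) < \<epsilon>"
    proof (cases "w = 0")
      case True
      then show ?thesis using eps by (intro exI[of _ 0]) (simp add: T.zero)
    next
      case False
      define t where "t = e / (2 * norm w)"
      have t: "t > 0" using e False by (simp add: t_def)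
      have "norm (t *\<^sub>R w) < e" using False e by (simp add: t_def)
      moreover have "t *\<^sub>R w \<in> ?R" by (rule subspace_scale[OF sR w])
      ultimately obtain x where x: "norm x \<le> 2 * real n" "norm (t *\<^sub>R w - T x) < t * \<epsilon>"
        using small[of "t *\<^sub>R w" "t * \<epsilon>"] t eps by auto
      let ?x = "inverse t *\<^sub>R x"
      have "w - T ?x = inverse t *\<^sub>R (t *\<^sub>R w - T x)"
        using t by (simp add: T.scaleR scaleR_right_diff_distrib)
      then have "norm (w - T ?x) = inverse t * norm (t *\<^sub>R w - T x)"
        using t by simp
      also have "\<dots> < inverse t * (t * \<epsilon>)"
        using x(2) t by (intro mult_strict_left_mono) auto
      also have "inverse t * (t * \<epsilon>) = \<epsilon>" using t by simp
      finally have 1: "norm (w - T ?x) < \<epsilon>" .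
      have "norm ?x \<le> inverse t * (2 * real n)"
        using x(1) t by (simp add: mult_left_mono)
      also have "\<dots> \<le> M * norm w"
        using e False by (simp add: t_def M_def field_simps)
      finally show ?thesis using 1 by blast
    qed
  qed
qed

text \<open>Approximate preimages are used to halve the residual again and again; the corrections
  are dominated by a geometric series, so they sum up in the complete domain, and the sum 2 of that
  series doubles the constant.\<close>

lemma bounded_preimages:
  fixes T :: "'a::banach \<Rightarrow> 'b::banach"
  assumes T: "bounded_linear T" and cl: "closed (range T)"
  obtains M where "M > 0" "\<And>w. w \<in> range T \<Longrightarrow> \<exists>x. T x = w \<and> norm x \<le> M * norm w"
proof -
  interpret T: bounded_linear T by (rule T)
  obtain M where M: "M > 0"
    "\<And>w \<epsilon>. w \<in> range T \<Longrightarrow> \<epsilon> > 0 \<Longrightarrow> \<exists>x. norm x \<le> M * norm w \<and> norm (w - T x) < \<epsilon>"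
    using approximate_preimages[OF T cl] by blast
  have step: "\<exists>x. norm x \<le> M * norm w \<and> norm (w - T x) \<le> norm w / 2" if "w \<in> range T" for w
  proof (cases "w = 0")
    case True
    then show ?thesis by (intro exI[of _ 0]) (simp add: T.zero)
  next
    case False
    then show ?thesis using M(2)[OF that, of "norm w / 2"] by force
  qed
  then obtain g where g: "\<And>w. w \<in> range T \<Longrightarrow> norm (g w) \<le> M * norm w \<and> norm (w - T (g w)) \<le> norm w / 2"
    by metis
  have "\<exists>x. T x = w \<and> norm x \<le> (2 * M) * norm w" if w: "w \<in> range T" for w
  proof -
    \<comment> \<open>The residual after \<open>k\<close> corrections: the sum of the first
      \<open>k\<close> corrections is mapped by \<open>T\<close> to \<open>w - r k\<close>.\<close>
    define r where "r k = ((\<lambda>v. v - T (g v)) ^^ k) w" for k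
    have r0: "r 0 = w" and rS: "r (Suc k) = r k - T (g (r k))" for k
      by (simp_all add: r_def)
    have rR: "r k \<in> range T" for k
    proof (induction k)
      case 0 then show ?case using w r0 by simp
    next
      case (Suc k)
      then obtain a where "r k = T a" by auto
      then have "r (Suc k) = T (a - g (r k))" by (simp add: rS T.diff)
      then show ?case by simp
    qed
    have rn: "norm (r k) \<le> norm w * (1 / 2) ^ k" for k
    proof (induction k)
      case 0 then show ?case by (simp add: r0)
    next
      case (Suc k)
      have "norm (r (Suc k)) \<le> norm (r k) / 2" using g[OF rR] rS by simp
      then show ?case using Suc by simp
    qed
    have gn: "norm (g (r k)) \<le> (M * norm w) * (1 / 2) ^ k" for k
    proof -
      have "norm (g (r k)) \<le> M * norm (r k)" using g[OF rR] by simp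
      also have "\<dots> \<le> M * (norm w * (1 / 2) ^ k)" using rn M(1) by (intro mult_left_mono) auto
      finally show ?thesis by simp
    qed
    have geo: "(\<lambda>k. (M * norm w) * (1 / 2) ^ k) sums ((M * norm w) * 2)"
      using sums_mult[OF geometric_sums[of "1/2::real"], of "M * norm w"] by simp
    have sn: "summable (\<lambda>k. norm (g (r k)))"
      by (rule summable_comparison_test'[OF sums_summable[OF geo], of 0]) (use gn in simp)
    then have sg: "summable (\<lambda>k. g (r k))" by (rule summable_norm_cancel)
    define x where "x = (\<Sum>k. g (r k))"
    have "norm x \<le> (\<Sum>k. norm (g (r k)))" unfolding x_def by (rule summable_norm[OF sn])
    also have "\<dots> \<le> (\<Sum>k. (M * norm w) * (1 / 2) ^ k)"
      by (rule suminf_le[OF gn sn sums_summable[OF geo]])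
    also have "\<dots> = 2 * M * norm w" using sums_unique[OF geo] by simp
    finally have nx: "norm x \<le> 2 * M * norm w" .
    have "(\<lambda>k. T (g (r k))) sums T x"
      using T.sums[OF summable_sums[OF sg]] by (simp add: x_def)
    moreover have "(\<lambda>k. T (g (r k))) sums w"
    proof -
      have part: "(\<Sum>k<n. T (g (r k))) = w - r n" for n
        by (induction n) (simp_all add: r0 rS)
      have "(\<lambda>n. norm w * (1 / 2) ^ n) \<longlonglongrightarrow> norm w * 0"
        by (intro tendsto_mult tendsto_const LIMSEQ_realpow_zero) auto
      then have "r \<longlonglongrightarrow> 0"
        using Lim_null_comparison[of r "\<lambda>n. norm w * (1 / 2) ^ n" sequentially] rn by simp
      then have "(\<lambda>n. w - r n) \<longlonglongrightarrow> w - 0" by (intro tendsto_diff tendsto_const)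
      then show ?thesis by (simp add: sums_def part)
    qed
    ultimately have "T x = w" by (rule sums_unique2)
    then show ?thesis using nx by blast
  qed
  then show ?thesis using that[of "2 * M"] M(1) by simp
qed

section \<open>Dual spaces\<close>

text \<open>The duals of the whole space and of \<open>Y\<close> are both subspaces of this one
  ambient space, so relative dimensions in them can be compared by linear maps on it.\<close>

lemma vector_space_fun: "vector_space (\<lambda>c (f :: 'v \<Rightarrow> 'k::field) x. c * f x)"
  by unfold_locales (auto simp: fun_eq_iff algebra_simps)

lemma sum_fun_apply: "(\<Sum>i\<in>I. f i) x = (\<Sum>i\<in>I. (f i x :: 'k::comm_monoid_add))"
  by (induction I rule: infinite_finite_induct) auto

lemma carrier_dual_subsp:
  "f \<in> carrier (dual (subsp sc Y)) \<longleftrightarrow>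
     (\<forall>x\<in>Y. \<forall>y\<in>Y. f (x + y) = f x + f y) \<and> (\<forall>c. \<forall>x\<in>Y. f (sc c x) = c * f x) \<and>
     (\<exists>C. \<forall>x\<in>Y. norm (f x) \<le> C * norm x) \<and> (\<forall>x. x \<notin> Y \<longrightarrow> f x = 0)"
  by (auto simp: dual_def bounded_operators_def subsp_def)

lemma nrm_dual_subsp: "nrm (dual (subsp sc Y)) f = (SUP x\<in>{x \<in> Y. norm x \<le> 1}. norm (f x))"
  by (simp add: dual_def subsp_def)

lemma scl_dual: "scl (dual X) = (\<lambda>c f x. c * f x)"
  by (simp add: dual_def)

context banach_space_over
begin

text \<open>Normalize \<open>x\<close> by a scalar of modulus \<open>inverse (norm x)\<close>. The
  values on the unit ball must be shown bounded, since only then does the supremum dominate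
  them.\<close>

lemma norm_le_nrm_dual:
  assumes Y: "subspace Y" and f: "f \<in> carrier (dual (subsp sc Y))" and x: "x \<in> Y"
  shows "norm (f x) \<le> nrm (dual (subsp sc Y)) f * norm x"
proof (cases "x = 0")
  case True
  have "f 0 = 0"
    using f subspace_0[OF Y] unfolding carrier_dual_subsp by (metis add_cancel_left_left)
  then show ?thesis using True by simp
next
  case False
  obtain C where C: "\<And>x. x \<in> Y \<Longrightarrow> norm (f x) \<le> C * norm x"
    using f unfolding carrier_dual_subsp by blast
  have bdd: "bdd_above ((\<lambda>x. norm (f x)) ` {x \<in> Y. norm x \<le> 1})"
  proof (rule bdd_aboveI2)
    fix y assume y: "y \<in> {x \<in> Y. norm x \<le> 1}"
    then have "norm (f y) \<le> C * norm y" using C by simp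
    also have "\<dots> \<le> \<bar>C\<bar> * 1" using y by (intro mult_mono) auto
    finally show "norm (f y) \<le> \<bar>C\<bar>" by simp
  qed
  let ?c = "of_real (inverse (norm x)) :: 'k"
  have nc: "norm ?c = inverse (norm x)" by (simp add: norm_inverse)
  have "sc ?c x \<in> {x \<in> Y. norm x \<le> 1}"
    using subspace_scale[OF Y x] False by (simp add: norm_scale nc del: of_real_inverse)
  then have "norm (f (sc ?c x)) \<le> nrm (dual (subsp sc Y)) f"
    unfolding nrm_dual_subsp by (rule cSUP_upper[OF _ bdd])
  moreover have "f (sc ?c x) = ?c * f x"
    using f x unfolding carrier_dual_subsp by blast
  ultimately have "inverse (norm x) * norm (f x) \<le> nrm (dual (subsp sc Y)) f"
    by (simp only: norm_mult nc)
  then show ?thesis using False by (simp add: field_simps)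
qed

lemma nrm_dual_le:
  assumes Y: "subspace Y" and M: "0 \<le> M" "\<And>x. x \<in> Y \<Longrightarrow> norm (f x) \<le> M * norm x"
  shows "nrm (dual (subsp sc Y)) f \<le> M"
  unfolding nrm_dual_subsp
proof (rule cSUP_least)
  show "{x \<in> Y. norm x \<le> 1} \<noteq> {}" using subspace_0[OF Y] by force
  fix x assume x: "x \<in> {x \<in> Y. norm x \<le> 1}"
  then have "norm (f x) \<le> M * norm x" using M(2) by simp
  also have "\<dots> \<le> M * 1" using x M(1) by (intro mult_left_mono) auto
  finally show "norm (f x) \<le> M" by simp
qed

lemma nrm_dual_nonneg:
  assumes Y: "subspace Y" and f: "f \<in> carrier (dual (subsp sc Y))"
  shows "0 \<le> nrm (dual (subsp sc Y)) f"
proof (cases "Y = {0}")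
  case True
  then show ?thesis unfolding nrm_dual_subsp by (simp cong: conj_cong)
next
  case False
  then obtain x where x: "x \<in> Y" "x \<noteq> 0" using subspace_0[OF Y] by auto
  have "0 \<le> nrm (dual (subsp sc Y)) f * norm x"
    using norm_le_nrm_dual[OF Y f x(1)] norm_ge_zero order_trans by blast
  then show ?thesis using x(2) by (simp add: zero_le_mult_iff)
qed

lemma subspace_dual:
  assumes Y: "subspace Y"
  shows "module.subspace (\<lambda>c f x. c * f x) (carrier (dual (subsp sc Y)))"
proof -
  interpret fs: vector_space "\<lambda>c (f :: 'z \<Rightarrow> 'k) x. c * f x" by (rule vector_space_fun)
  show ?thesis
  proof (rule fs.subspaceI)
    show "0 \<in> carrier (dual (subsp sc Y))"
      unfolding carrier_dual_subsp by (auto intro: exI[of _ 0])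
  next
    fix f g assume fg: "f \<in> carrier (dual (subsp sc Y))" "g \<in> carrier (dual (subsp sc Y))"
    obtain C where C: "\<forall>x\<in>Y. norm (f x) \<le> C * norm x"
      using fg(1) unfolding carrier_dual_subsp by blast
    obtain D where D: "\<forall>x\<in>Y. norm (g x) \<le> D * norm x"
      using fg(2) unfolding carrier_dual_subsp by blast
    have "\<forall>x\<in>Y. norm (f x + g x) \<le> (C + D) * norm x"
    proof
      fix x assume "x \<in> Y"
      then show "norm (f x + g x) \<le> (C + D) * norm x"
        using C D norm_triangle_ineq[of "f x" "g x"] by (force simp: distrib_right)
    qed
    then have "\<exists>C. \<forall>x\<in>Y. norm (f x + g x) \<le> C * norm x" by blast
    then show "f + g \<in> carrier (dual (subsp sc Y))"
      using fg unfolding carrier_dual_subsp by (simp add: algebra_simps)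
  next
    fix c f assume f: "f \<in> carrier (dual (subsp sc Y))"
    obtain C where C: "\<forall>x\<in>Y. norm (f x) \<le> C * norm x"
      using f unfolding carrier_dual_subsp by blast
    have "\<forall>x\<in>Y. norm (c * f x) \<le> (norm c * C) * norm x"
      using C by (simp add: norm_mult mult.assoc mult_left_mono)
    then have "\<exists>C. \<forall>x\<in>Y. norm (c * f x) \<le> C * norm x" by blast
    then show "(\<lambda>x. c * f x) \<in> carrier (dual (subsp sc Y))"
      using f unfolding carrier_dual_subsp by (simp add: algebra_simps)
  qed
qed

lemma diff_in_dual:
  assumes Y: "subspace Y"
    and "f \<in> carrier (dual (subsp sc Y))" "g \<in> carrier (dual (subsp sc Y))"
  shows "f - g \<in> carrier (dual (subsp sc Y))"
proof -
  interpret fs: vector_space "\<lambda>c (f :: 'z \<Rightarrow> 'k) x. c * f x" by (rule vector_space_fun)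
  show ?thesis using fs.subspace_diff[OF subspace_dual[OF Y]] assms by blast
qed

text \<open>Definiteness rests on the convention for functionals: norm zero gives agreement on
  \<open>Y\<close>, and off \<open>Y\<close> all members of the carrier vanish.\<close>

lemma Metric_space_dual:
  assumes Y: "subspace Y"
  shows "Metric_space (carrier (dual (subsp sc Y))) (ndist (dual (subsp sc Y)))"
proof
  let ?D = "dual (subsp sc Y)"
  fix f g :: "'z \<Rightarrow> 'k"
  show "0 \<le> ndist ?D f g"
    using nrm_dual_nonneg[OF Y diff_in_dual[OF Y]] by (simp add: ndist_def)
  show "ndist ?D f g = ndist ?D g f"
    by (simp add: ndist_def nrm_dual_subsp norm_minus_commute)
next
  let ?D = "dual (subsp sc Y)"
  fix f g assume fg: "f \<in> carrier ?D" "g \<in> carrier ?D"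
  show "ndist ?D f g = 0 \<longleftrightarrow> f = g"
  proof
    assume "ndist ?D f g = 0"
    then have 0: "nrm ?D (f - g) = 0" using fg by (simp add: ndist_def)
    show "f = g"
    proof
      fix x
      show "f x = g x"
      proof (cases "x \<in> Y")
        case True
        then show ?thesis using norm_le_nrm_dual[OF Y diff_in_dual[OF Y fg] True] 0 by simp
      next
        case False
        then show ?thesis using fg unfolding carrier_dual_subsp by simp
      qed
    qed
  next
    assume "f = g"
    moreover have "nrm ?D (f - f) \<le> 0" by (rule nrm_dual_le[OF Y]) auto
    ultimately show "ndist ?D f g = 0"
      using fg nrm_dual_nonneg[OF Y diff_in_dual[OF Y fg(1) fg(1)]] by (simp add: ndist_def)
  qed
  fix h assume h: "h \<in> carrier ?D"
  have "nrm ?D (f - h) \<le> nrm ?D (f - g) + nrm ?D (g - h)"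
  proof (rule nrm_dual_le[OF Y])
    show "0 \<le> nrm ?D (f - g) + nrm ?D (g - h)"
      using nrm_dual_nonneg[OF Y diff_in_dual[OF Y]] fg h by (simp add: add_nonneg_nonneg)
    fix x assume x: "x \<in> Y"
    have "norm ((f - h) x) \<le> norm ((f - g) x) + norm ((g - h) x)"
      using norm_triangle_ineq[of "(f - g) x" "(g - h) x"] by simp
    also have "\<dots> \<le> nrm ?D (f - g) * norm x + nrm ?D (g - h) * norm x"
      using norm_le_nrm_dual[OF Y diff_in_dual[OF Y fg] x]
        norm_le_nrm_dual[OF Y diff_in_dual[OF Y fg(2) h] x] by (rule add_mono)
    finally show "norm ((f - h) x) \<le> (nrm ?D (f - g) + nrm ?D (g - h)) * norm x"
      by (simp add: distrib_right)
  qed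
  then show "ndist ?D f h \<le> ndist ?D f g + ndist ?D g h"
    using fg h by (simp add: ndist_def)
qed

text \<open>The sequential form is the one that can be compared with closedness in the operator
  type.\<close>

lemma closedin_dual_iff:
  assumes Y: "subspace Y"
  defines "D \<equiv> dual (subsp sc Y)"
  shows "closedin (ntopology D) S \<longleftrightarrow> S \<subseteq> carrier D \<and>
    (\<forall>\<sigma> g. (\<forall>n. \<sigma> n \<in> S) \<longrightarrow> g \<in> carrier D \<longrightarrow> (\<lambda>n. nrm D (\<sigma> n - g)) \<longlonglongrightarrow> 0 \<longrightarrow> g \<in> S)"
proof -
  interpret M: Metric_space "carrier D" "ndist D"
    unfolding D_def by (rule Metric_space_dual[OF Y])
  have lim: "limitin M.mtopology \<sigma> g sequentially \<longleftrightarrow>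
      g \<in> carrier D \<and> (\<lambda>n. nrm D (\<sigma> n - g)) \<longlonglongrightarrow> 0"
    if S: "S \<subseteq> carrier D" "\<And>n. \<sigma> n \<in> S" for \<sigma> g
  proof -
    have "\<sigma> n \<in> carrier D" for n using S by auto
    then have "(\<lambda>n. ndist D (\<sigma> n) g) = (\<lambda>n. nrm D (\<sigma> n - g))" if "g \<in> carrier D"
      using that by (simp add: ndist_def)
    then show ?thesis
      using \<open>\<And>n. \<sigma> n \<in> carrier D\<close> unfolding M.limitin_metric_dist_null by auto
  qed
  show ?thesis
    unfolding ntopology_def M.metric_closedin_iff_sequentially_closed
  proof (intro conj_cong refl iff_allI)
    fix \<sigma> g assume S: "S \<subseteq> carrier D"
    show "(range \<sigma> \<subseteq> S \<and> limitin M.mtopology \<sigma> g sequentially \<longrightarrow> g \<in> S) \<longleftrightarrow>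
      ((\<forall>n. \<sigma> n \<in> S) \<longrightarrow> g \<in> carrier D \<longrightarrow> (\<lambda>n. nrm D (\<sigma> n - g)) \<longlonglongrightarrow> 0 \<longrightarrow> g \<in> S)"
    proof (cases "\<forall>n. \<sigma> n \<in> S")
      case True
      then show ?thesis using lim[OF S, of \<sigma> g] by (auto simp: image_subset_iff)
    next
      case False
      then show ?thesis by (auto simp: image_subset_iff)
    qed
  qed
qed

text \<open>Functionals are homogeneous over \<open>'k\<close>; \<open>scale_of_real\<close> turns
  this into real homogeneity, which places the dual inside the Banach space type
  \<open>'z \<Rightarrow>\<^sub>L 'k\<close>.\<close>

lemma bounded_linear_functional:
  assumes f: "f \<in> carrier (dual (whole sc))"
  shows "bounded_linear f"
proof -
  obtain C where C: "\<And>x. norm (f x) \<le> C * norm x"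
    using f unfolding carrier_dual_subsp by auto
  show ?thesis
  proof (rule bounded_linear_intro[where K = C])
    show "f (x + y) = f x + f y" for x y
      using f unfolding carrier_dual_subsp by simp
    show "f (r *\<^sub>R x) = r *\<^sub>R f x" for r x
    proof -
      have "f (sc (of_real r) x) = of_real r * f x"
        using f unfolding carrier_dual_subsp by simp
      then show ?thesis by (simp add: scale_of_real scaleR_conv_of_real)
    qed
    show "norm (f x) \<le> norm x * C" for x using C[of x] by (simp add: mult.commute)
  qed
qed

lemma blinfun_apply_in_dual:
  "blinfun_apply w \<in> carrier (dual (whole sc)) \<longleftrightarrow>
     (\<forall>c x. blinfun_apply w (sc c x) = c * blinfun_apply w x)"
  unfolding carrier_dual_subsp by (auto simp: blinfun.add_right intro: exI[of _ "norm w"] norm_blinfun)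

end

text \<open>Makes the results on closed spans available for subspaces of the operator type. The
  upper bound for the norm of a multiple is direct; the lower bound is the upper bound applied to
  the inverse scalar.\<close>

lemma banach_space_over_blinfun:
  "banach_space_over (\<lambda>(c :: 'k::{real_normed_field,banach}) (w :: 'z::banach \<Rightarrow>\<^sub>L 'k).
     blinfun_mult_right c o\<^sub>L w)"
proof (unfold_locales)
  fix a b :: 'k and x y :: "'z \<Rightarrow>\<^sub>L 'k"
  show "blinfun_mult_right a o\<^sub>L (x + y) = (blinfun_mult_right a o\<^sub>L x) + (blinfun_mult_right a o\<^sub>L y)"
    by (rule blinfun_eqI) (simp add: blinfun.add_left algebra_simps)
  show "blinfun_mult_right (a + b) o\<^sub>L x = (blinfun_mult_right a o\<^sub>L x) + (blinfun_mult_right b o\<^sub>L x)"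
    by (rule blinfun_eqI) (simp add: blinfun.add_left algebra_simps)
  show "blinfun_mult_right a o\<^sub>L (blinfun_mult_right b o\<^sub>L x) = blinfun_mult_right (a * b) o\<^sub>L x"
    by (rule blinfun_eqI) (simp add: algebra_simps)
  show "blinfun_mult_right 1 o\<^sub>L x = x"
    by (rule blinfun_eqI) simp
  have le: "norm (blinfun_mult_right c o\<^sub>L w) \<le> norm c * norm w" for c and w :: "'z \<Rightarrow>\<^sub>L 'k"
  proof (rule norm_blinfun_bound)
    fix z show "norm ((blinfun_mult_right c o\<^sub>L w) z) \<le> norm c * norm w * norm z"
      using norm_blinfun[of w z] by (simp add: norm_mult mult.assoc mult_left_mono)
  qed simp
  show "norm (blinfun_mult_right a o\<^sub>L x) = norm a * norm x"
  proof (cases "a = 0")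
    case True
    then show ?thesis using le[of a x] by simp
  next
    case False
    have "x = blinfun_mult_right (inverse a) o\<^sub>L (blinfun_mult_right a o\<^sub>L x)"
      using False by (intro blinfun_eqI) simp
    then have "norm x \<le> norm (inverse a) * norm (blinfun_mult_right a o\<^sub>L x)"
      using le[of "inverse a" "blinfun_mult_right a o\<^sub>L x"] by simp
    then have "norm x \<le> norm (blinfun_mult_right a o\<^sub>L x) / norm a"
      by (simp only: norm_inverse divide_inverse mult.commute)
    then have "norm a * norm x \<le> norm (blinfun_mult_right a o\<^sub>L x)"
      using False by (simp add: le_divide_eq mult.commute)
    then show ?thesis using le[of a x] by simp
  qed
qed

section \<open>Closed subspaces of finite codimension\<close>

context banach_space_over
begin

text \<open>\<open>\<phi> b\<close> reads off the coordinate at \<open>b\<close> after the algebraic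
  projection along \<open>Y\<close>. It vanishes on the closed span of \<open>Y\<close> and the
  other basis vectors and has value 1 at \<open>b\<close>, so the distance of \<open>b\<close> from
  that span bounds it.\<close>

lemma complement_coefficient_functionals:
  assumes Y: "closed Y" and B: "finite B" "complement_basis sc Y UNIV B"
  obtains \<phi> where "\<And>b. b \<in> B \<Longrightarrow> \<phi> b \<in> carrier (dual (whole sc))"
    "\<And>b y. b \<in> B \<Longrightarrow> y \<in> Y \<Longrightarrow> \<phi> b y = 0"
    "\<And>b b'. b \<in> B \<Longrightarrow> b' \<in> B \<Longrightarrow> \<phi> b b' = (if b = b' then 1 else 0)"
    "\<And>x. x - (\<Sum>b\<in>B. sc (\<phi> b x) b) \<in> Y"
proof -
  have sY: "subspace Y" and indB: "independent B"
    using B(2) by (auto simp: complement_basis_def)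
  obtain p where p: "Vector_Spaces.linear sc sc p" "\<And>v. v \<in> Y \<Longrightarrow> p v = 0"
    "\<And>e. e \<in> span B \<Longrightarrow> p e = e"
    using complement_basis_projection[OF B(2)] by blast
  interpret p: Vector_Spaces.linear sc sc p by (rule p(1))
  define \<phi> where "\<phi> b x = representation B (p x) b" for b x
  have px: "p x \<in> span B \<and> x - p x \<in> Y" for x
  proof -
    have "x \<in> {v + e |v e. v \<in> Y \<and> e \<in> span B}"
      using B(2) by (simp add: complement_basis_def)
    then obtain v e where x: "x = v + e" "v \<in> Y" "e \<in> span B" by blast
    then have "p x = e" using p(2,3) by (simp add: p.add)
    then show ?thesis using x by simp
  qed
  have sum: "p x = (\<Sum>b\<in>B. sc (\<phi> b x) b)" for x
    unfolding \<phi>_def by (rule sum_representation_eq[OF indB _ B(1) subset_refl, symmetric]) (simp add: px)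
  have add: "\<phi> b (x + y) = \<phi> b x + \<phi> b y" for b x y
    unfolding \<phi>_def p.add using px by (simp add: representation_add[OF indB])
  have scale: "\<phi> b (sc c x) = c * \<phi> b x" for b c x
    unfolding \<phi>_def p.scale using px by (simp add: representation_scale[OF indB])
  have Y0: "\<phi> b y = 0" if "y \<in> Y" for b y
    unfolding \<phi>_def p(2)[OF that] by (simp add: representation_zero)
  have delta: "\<phi> b b' = (if b = b' then 1 else 0)" if "b' \<in> B" for b b'
    unfolding \<phi>_def p(3)[OF span_base[OF that]] representation_basis[OF indB that] by simp
  have bdd: "\<exists>C. \<forall>x. norm (\<phi> b x) \<le> C * norm x" if b: "b \<in> B" for b
  proof -
    let ?V = "span ((B - {b}) \<union> Y)"
    have clV: "closed ?V"
      using B(1) by (intro closed_span_Un_finite sY Y) auto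
    have V0: "\<phi> b v = 0" if "v \<in> ?V" for v
      using that
    proof (induction rule: span_induct_alt)
      case base
      show ?case using Y0[OF subspace_0[OF sY]] .
    next
      case (step c x y)
      then have "\<phi> b x = 0" using Y0 delta[of x b] by auto
      then show ?case using step by (simp add: add scale)
    qed
    have "\<phi> b b = 1" using delta[OF b] by simp
    then have bV: "b \<notin> ?V" using V0 by auto
    obtain d where d: "d > 0" "\<And>c x. x - sc c b \<in> ?V \<Longrightarrow> norm c * d \<le> norm x"
      using separation_from_closed[OF subspace_span clV bV] by blast
    have "norm (\<phi> b x) * d \<le> norm x" for x
    proof (rule d(2))
      have "p x = sc (\<phi> b x) b + (\<Sum>b'\<in>B - {b}. sc (\<phi> b' x) b')"
        unfolding sum by (rule sum.remove[OF B(1) b])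
      then have eq: "x - sc (\<phi> b x) b = (x - p x) + (\<Sum>b'\<in>B - {b}. sc (\<phi> b' x) b')"
        by simp
      show "x - sc (\<phi> b x) b \<in> ?V"
        unfolding eq using px by (intro span_add span_sum span_scale span_base) auto
    qed
    then have "norm (\<phi> b x) \<le> (1 / d) * norm x" for x
      using d(1) by (simp add: pos_le_divide_eq)
    then show ?thesis by blast
  qed
  show ?thesis
  proof
    show "\<phi> b \<in> carrier (dual (whole sc))" if "b \<in> B" for b
      unfolding carrier_dual_subsp using bdd[OF that] by (simp add: add scale)
    show "x - (\<Sum>b\<in>B. sc (\<phi> b x) b) \<in> Y" for x
      using px[of x] by (simp add: sum)
  qed (use Y0 delta in auto)
qed

definition annihilator :: "'z set \<Rightarrow> ('z \<Rightarrow> 'k) set" where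
  "annihilator Y = {f \<in> carrier (dual (whole sc)). \<forall>y\<in>Y. f y = 0}"

lemma subspace_annihilator: "module.subspace (\<lambda>c f x. c * f x) (annihilator Y)"
proof -
  interpret fs: vector_space "\<lambda>c (f :: 'z \<Rightarrow> 'k) x. c * f x" by (rule vector_space_fun)
  have D: "fs.subspace (carrier (dual (whole sc)))" by (rule subspace_dual[OF subspace_UNIV])
  show ?thesis
    unfolding annihilator_def
    using fs.subspace_0[OF D] fs.subspace_add[OF D] fs.subspace_scale[OF D]
    by (intro fs.subspaceI) auto
qed

text \<open>The coefficient functionals form a basis. Evaluation at the vectors of \<open>B\<close>
  gives independence; a functional \<open>f\<close> that kills \<open>Y\<close> is the combination
  with coefficients \<open>f b\<close>, because every \<open>x\<close> differs from its
  \<open>B\<close> component by an element of \<open>Y\<close>.\<close>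

lemma rel_dim_annihilator:
  assumes Y: "closed Y" and n: "rel_dim sc Y UNIV n"
  shows "rel_dim (\<lambda>c f x. c * f x) {0} (annihilator Y) n"
proof -
  interpret fs: vector_space "\<lambda>c (f :: 'z \<Rightarrow> 'k) x. c * f x" by (rule vector_space_fun)
  obtain B where B: "complement_basis sc Y UNIV B" "finite B" "card B = n"
    using n by (auto simp: rel_dim_def)
  obtain \<phi> where \<phi>: "\<And>b. b \<in> B \<Longrightarrow> \<phi> b \<in> carrier (dual (whole sc))"
    "\<And>b y. b \<in> B \<Longrightarrow> y \<in> Y \<Longrightarrow> \<phi> b y = 0"
    "\<And>b b'. b \<in> B \<Longrightarrow> b' \<in> B \<Longrightarrow> \<phi> b b' = (if b = b' then 1 else 0)"
    "\<And>x. x - (\<Sum>b\<in>B. sc (\<phi> b x) b) \<in> Y"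
    by (rule complement_coefficient_functionals[OF Y B(2,1)]) blast
  have inj: "inj_on \<phi> B"
  proof (rule inj_onI)
    fix b b' assume b: "b \<in> B" "b' \<in> B" and eq: "\<phi> b = \<phi> b'"
    have "\<phi> b b' = 1" using \<phi>(3)[OF b(2,2)] eq by simp
    then show "b = b'" using \<phi>(3)[OF b] by (simp split: if_splits)
  qed
  have ind: "fs.independent (\<phi> ` B)"
  proof (rule fs.independent_if_scalars_zero)
    show "finite (\<phi> ` B)" using B by simp
    fix u e assume s: "(\<Sum>e\<in>\<phi> ` B. (\<lambda>x. u e * e x)) = 0" and "e \<in> \<phi> ` B"
    then obtain b where b: "b \<in> B" "e = \<phi> b" by auto
    have "0 = (\<Sum>e\<in>\<phi> ` B. (\<lambda>x. u e * e x)) b" using s by simp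
    also have "\<dots> = (\<Sum>b'\<in>B. u (\<phi> b') * \<phi> b' b)"
      by (simp add: sum_fun_apply sum.reindex[OF inj])
    also have "\<dots> = (\<Sum>b'\<in>B. if b' = b then u (\<phi> b') else 0)"
      using \<phi>(3) b by (intro sum.cong) auto
    also have "\<dots> = u e" using b B by simp
    finally show "u e = 0" by simp
  qed
  have span: "fs.span (\<phi> ` B) = annihilator Y"
  proof (rule fs.span_subspace)
    show "\<phi> ` B \<subseteq> annihilator Y" using \<phi>(1,2) by (auto simp: annihilator_def)
    show "annihilator Y \<subseteq> fs.span (\<phi> ` B)"
    proof
      fix f assume "f \<in> annihilator Y"
      then have f: "\<And>x y. f (x + y) = f x + f y" "\<And>c x. f (sc c x) = c * f x" "\<And>y. y \<in> Y \<Longrightarrow> f y = 0"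
        by (auto simp: annihilator_def carrier_dual_subsp)
      have fx: "f x = (\<Sum>b\<in>B. f b * \<phi> b x)" for x
      proof -
        interpret f: Vector_Spaces.linear sc "(*)" f
          by unfold_locales (auto simp: f algebra_simps)
        have "f (x - (\<Sum>b\<in>B. sc (\<phi> b x) b)) = 0" using \<phi>(4) f(3) by blast
        then show ?thesis by (simp add: f.diff f.sum f(2) mult.commute)
      qed
      have "f = (\<Sum>b\<in>B. (\<lambda>x. f b * \<phi> b x))"
      proof
        show "f x = (\<Sum>b\<in>B. (\<lambda>x. f b * \<phi> b x)) x" for x
          using fx[of x] by (simp only: sum_fun_apply)
      qed
      also have "\<dots> \<in> fs.span (\<phi> ` B)"
        by (intro fs.span_sum fs.span_scale fs.span_base) auto
      finally show "f \<in> fs.span (\<phi> ` B)" .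
    qed
  qed (rule subspace_annihilator)
  have "complement_basis (\<lambda>c f x. c * f x) {0} (annihilator Y) (\<phi> ` B)"
    unfolding complement_basis_def using ind span fs.span_zero[of "\<phi> ` B"] by auto
  then show ?thesis
    unfolding rel_dim_def using B card_image[OF inj] by blast
qed

text \<open>Subtracting the \<open>B\<close> component is bounded because the coefficient
  functionals are. Composition with \<open>P\<close> will be the extension operator for functionals
  on \<open>Y\<close>.\<close>

lemma complement_projection:
  assumes Y: "closed Y" and n: "rel_dim sc Y UNIV n"
  obtains P C where "Vector_Spaces.linear sc sc P" "\<And>x. P x \<in> Y" "\<And>y. y \<in> Y \<Longrightarrow> P y = y"
    "0 \<le> C" "\<And>x. norm (P x) \<le> C * norm x"
proof -
  obtain B where B: "complement_basis sc Y UNIV B" "finite B" "card B = n"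
    using n by (auto simp: rel_dim_def)
  obtain \<phi> where \<phi>: "\<And>b. b \<in> B \<Longrightarrow> \<phi> b \<in> carrier (dual (whole sc))"
    "\<And>b y. b \<in> B \<Longrightarrow> y \<in> Y \<Longrightarrow> \<phi> b y = 0"
    "\<And>b b'. b \<in> B \<Longrightarrow> b' \<in> B \<Longrightarrow> \<phi> b b' = (if b = b' then 1 else 0)"
    "\<And>x. x - (\<Sum>b\<in>B. sc (\<phi> b x) b) \<in> Y"
    by (rule complement_coefficient_functionals[OF Y B(2,1)]) blast
  have \<phi>_lin: "\<phi> b (x + y) = \<phi> b x + \<phi> b y" "\<phi> b (sc c x) = c * \<phi> b x" if "b \<in> B" for b x y c
    using \<phi>(1)[OF that] by (auto simp: carrier_dual_subsp)
  have "\<forall>b\<in>B. \<exists>c. \<forall>x. norm (\<phi> b x) \<le> c * norm x"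
    using \<phi>(1) by (auto simp: carrier_dual_subsp)
  then obtain K where K: "\<And>b x. b \<in> B \<Longrightarrow> norm (\<phi> b x) \<le> K b * norm x"
    by metis
  define P where "P x = x - (\<Sum>b\<in>B. sc (\<phi> b x) b)" for x
  define C where "C = 1 + (\<Sum>b\<in>B. \<bar>K b\<bar> * norm b)"
  show ?thesis
  proof
    show "Vector_Spaces.linear sc sc P"
    proof unfold_locales
      fix x y c
      show "P (x + y) = P x + P y"
        by (simp add: P_def \<phi>_lin scale_left_distrib sum.distrib)
      show "P (sc c x) = sc c (P x)"
        by (simp add: P_def \<phi>_lin scale_right_diff_distrib scale_sum_right)
    qed
    show "P x \<in> Y" for x unfolding P_def by (rule \<phi>(4))
    show "P y = y" if "y \<in> Y" for y
      using \<phi>(2)[OF _ that] by (simp add: P_def)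
    show "0 \<le> C" unfolding C_def by (intro add_nonneg_nonneg sum_nonneg) auto
    show "norm (P x) \<le> C * norm x" for x
    proof -
      have "norm (P x) \<le> norm x + norm (\<Sum>b\<in>B. sc (\<phi> b x) b)"
        unfolding P_def by (rule norm_triangle_ineq4)
      also have "norm (\<Sum>b\<in>B. sc (\<phi> b x) b) \<le> (\<Sum>b\<in>B. norm (\<phi> b x) * norm b)"
        using norm_sum[of "\<lambda>b. sc (\<phi> b x) b" B] by (simp add: norm_scale)
      also have "\<dots> \<le> (\<Sum>b\<in>B. (\<bar>K b\<bar> * norm b) * norm x)"
      proof (rule sum_mono)
        fix b assume "b \<in> B"
        then have "norm (\<phi> b x) \<le> K b * norm x" by (rule K)
        also have "\<dots> \<le> \<bar>K b\<bar> * norm x" by (intro mult_right_mono) auto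
        finally have "norm (\<phi> b x) * norm b \<le> (\<bar>K b\<bar> * norm x) * norm b"
          by (intro mult_right_mono) auto
        then show "norm (\<phi> b x) * norm b \<le> (\<bar>K b\<bar> * norm b) * norm x"
          by (simp only: mult_ac)
      qed
      finally show ?thesis
        by (simp add: C_def distrib_right sum_distrib_right)
    qed
  qed
qed

text \<open>The sum is pulled back along \<open>blinfun_apply\<close>, so that closedness refers to
  the norm of a Banach space type, in which \<open>S\<close> is the copy of \<open>T\<close>. The
  closed range enters through bounded preimages, the finite-dimensional kernel through the
  closedness of \<open>span (B \<union> Y)\<close>.\<close>

lemma closed_annihilator_plus_image:
  assumes Y: "closed Y" "rel_dim sc Y UNIV n"
    and T: "T \<in> bounded_operators (whole sc) (dual (whole sc))"
    and ker: "finite_dim (whole sc) (ker (whole sc) T)"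
    and ran: "closedin (ntopology (dual (whole sc))) (range T)"
  shows "closed {w :: 'z \<Rightarrow>\<^sub>L 'k. blinfun_apply w \<in> {l + g |l g. l \<in> annihilator Y \<and> g \<in> T ` Y}}"
proof -
  interpret fs: vector_space "\<lambda>c (f :: 'z \<Rightarrow> 'k) x. c * f x" by (rule vector_space_fun)
  interpret bs: banach_space_over "\<lambda>(c :: 'k) (w :: 'z \<Rightarrow>\<^sub>L 'k). blinfun_mult_right c o\<^sub>L w"
    by (rule banach_space_over_blinfun)
  let ?D = "dual (whole sc)" and ?bs = "\<lambda>(c :: 'k) (w :: 'z \<Rightarrow>\<^sub>L 'k). blinfun_mult_right c o\<^sub>L w"
  have sY: "subspace Y" by (rule rel_dim_subspaces[OF Y(2)])
  have TD: "T z \<in> carrier ?D" for z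
    using T by (auto simp: bounded_operators_def subsp_def)
  have Tadd: "T (x + y) = T x + T y" and Tscale: "T (sc c x) = (\<lambda>z. c * T x z)" for x y c
    using T by (auto simp: bounded_operators_def subsp_def scl_dual)
  obtain CT where CT: "\<And>x. nrm ?D (T x) \<le> CT * norm x"
    using T by (auto simp: bounded_operators_def subsp_def)
  define S where "S z = Blinfun (T z)" for z
  have S: "blinfun_apply (S z) = T z" for z
    unfolding S_def by (rule bounded_linear_Blinfun_apply[OF bounded_linear_functional[OF TD]])
  have Slin: "S (x + y) = S x + S y" "S (sc c x) = ?bs c (S x)" for x y c
    by (rule blinfun_eqI, simp add: S Tadd Tscale blinfun.add_left)+
  have blS: "bounded_linear S"
  proof (rule bounded_linear_intro[where K = "\<bar>CT\<bar>"])
    show "S (x + y) = S x + S y" for x y by (rule Slin)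
    show "S (r *\<^sub>R x) = r *\<^sub>R S x" for r x
      using Slin(2)[of "of_real r" x] bs.scale_of_real[of r "S x"] by (simp add: scale_of_real)
    fix x
    show "norm (S x) \<le> norm x * \<bar>CT\<bar>"
    proof (rule norm_blinfun_bound)
      fix z
      have "norm (T x z) \<le> nrm ?D (T x) * norm z"
        by (rule norm_le_nrm_dual[OF subspace_UNIV TD]) simp
      also have "\<dots> \<le> (norm x * \<bar>CT\<bar>) * norm z"
      proof (rule mult_right_mono)
        have "CT * norm x \<le> \<bar>CT\<bar> * norm x" by (intro mult_right_mono) auto
        then show "nrm ?D (T x) \<le> norm x * \<bar>CT\<bar>"
          using CT[of x] by (simp add: mult.commute)
      qed simp
      finally show "norm (blinfun_apply (S x) z) \<le> norm x * \<bar>CT\<bar> * norm z"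
        by (simp only: S)
    qed simp
  qed
  interpret S: bounded_linear S by (rule blS)
  \<comment> \<open>A norm limit of operators in the range is again homogeneous over
    \<open>'k\<close>, hence in the dual, and the operator norm dominates \<open>nrm\<close> of the
    differences; so the closedness of \<open>range T\<close> in the dual captures the limit.\<close>
  have clS: "closed (range S)"
    unfolding closed_sequential_limits
  proof (intro allI impI)
    fix f l assume fl: "(\<forall>n. f n \<in> range S) \<and> f \<longlonglongrightarrow> l"
    then have "\<forall>n. \<exists>z. f n = S z" by blast
    then obtain z where z: "\<And>n. f n = S (z n)" by metis
    have pt: "(\<lambda>n. blinfun_apply (f n) x) \<longlonglongrightarrow> blinfun_apply l x" for x
      using fl by (intro blinfun.tendsto tendsto_const) auto
    have lD: "blinfun_apply l \<in> carrier ?D"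
      unfolding blinfun_apply_in_dual
    proof (intro allI)
      fix c x
      have "(\<lambda>n. blinfun_apply (f n) (sc c x)) \<longlonglongrightarrow> c * blinfun_apply l x"
        using tendsto_mult[OF tendsto_const pt, of c x] TD unfolding z S carrier_dual_subsp by simp
      then show "blinfun_apply l (sc c x) = c * blinfun_apply l x"
        using pt[of "sc c x"] LIMSEQ_unique by blast
    qed
    have lim: "(\<lambda>n. nrm ?D (T (z n) - blinfun_apply l)) \<longlonglongrightarrow> 0"
    proof (rule Lim_null_comparison)
      show "(\<lambda>n. norm (f n - l)) \<longlonglongrightarrow> 0"
        using fl by (intro tendsto_norm_zero LIM_zero) auto
      show "\<forall>\<^sub>F n in sequentially. norm (nrm ?D (T (z n) - blinfun_apply l)) \<le> norm (f n - l)"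
      proof (rule always_eventually, rule allI)
        fix n
        have "nrm ?D (T (z n) - blinfun_apply l) \<le> norm (f n - l)"
        proof (rule nrm_dual_le[OF subspace_UNIV])
          fix x
          show "norm ((T (z n) - blinfun_apply l) x) \<le> norm (f n - l) * norm x"
            using norm_blinfun[of "f n - l" x] by (simp add: z S blinfun.diff_left)
        qed simp
        then show "norm (nrm ?D (T (z n) - blinfun_apply l)) \<le> norm (f n - l)"
          using nrm_dual_nonneg[OF subspace_UNIV diff_in_dual[OF subspace_UNIV TD lD]] by simp
      qed
    qed
    have "blinfun_apply l \<in> range T"
      by (rule ran[unfolded closedin_dual_iff[OF subspace_UNIV], THEN conjunct2, rule_format,
            OF _ lD lim]) simp
    then obtain x where "blinfun_apply l = T x" by auto
    then have "l = S x" by (intro blinfun_eqI) (simp add: S)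
    then show "l \<in> range S" by simp
  qed
  obtain M where M: "M > 0" "\<And>w. w \<in> range S \<Longrightarrow> \<exists>x. S x = w \<and> norm x \<le> M * norm w"
    using bounded_preimages[OF blS clS] by blast
  obtain B where B: "finite B" "B \<subseteq> ker (whole sc) T" "ker (whole sc) T \<subseteq> span B"
    using ker by (auto simp: finite_dim_def subsp_def)
  have S0: "S x = 0 \<longleftrightarrow> x \<in> ker (whole sc) T" for x
  proof -
    have "S x = 0 \<longleftrightarrow> blinfun_apply (S x) = blinfun_apply 0" by (simp add: blinfun_apply_inject)
    also have "\<dots> \<longleftrightarrow> T x = 0" by (simp add: S fun_eq_iff)
    finally show ?thesis by (simp add: ker_def subsp_def)
  qed
  have spanB: "S p = 0" if "p \<in> span B" for p
    using that
  proof (induction rule: span_induct_alt)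
    case base
    show ?case by (rule S.zero)
  next
    case (step c x y)
    then have "S x = 0" using S0 B(2) by blast
    then show ?case using step by (simp add: Slin)
  qed
  have clBY: "closed (span (B \<union> Y))"
    by (rule closed_span_Un_finite[OF sY Y(1) B(1)])
  have clSY: "closed (S ` Y)"
    unfolding closed_sequential_limits
  proof (intro allI impI)
    fix f l assume fl: "(\<forall>n. f n \<in> S ` Y) \<and> f \<longlonglongrightarrow> l"
    then have "\<forall>n. \<exists>y. y \<in> Y \<and> f n = S y" by blast
    then obtain y where y: "\<And>n. y n \<in> Y" "\<And>n. f n = S (y n)" by metis
    have "l \<in> range S"
      using closed_sequentially[OF clS, of f l] fl y by blast
    then obtain z where z: "l = S z" by blast
    \<comment> \<open>With such a \<open>u n\<close>, the point \<open>z + u n\<close> has the same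
      image as \<open>y n\<close> and tends to \<open>z\<close>; it therefore stays in the closed
      space spanned by \<open>Y\<close> and the kernel.\<close>
    have "\<exists>u. S u = f n - l \<and> norm u \<le> M * norm (f n - l)" for n
    proof (rule M(2))
      have "f n - l = S (y n - z)" by (simp add: y z S.diff)
      then show "f n - l \<in> range S" by blast
    qed
    then obtain u where u: "\<And>n. S (u n) = f n - l" "\<And>n. norm (u n) \<le> M * norm (f n - l)"
      by metis
    have "(\<lambda>n. M * norm (f n - l)) \<longlonglongrightarrow> M * 0"
      using fl by (intro tendsto_mult tendsto_const tendsto_norm_zero LIM_zero) auto
    then have "u \<longlonglongrightarrow> 0"
      using Lim_null_comparison[of u "\<lambda>n. M * norm (f n - l)" sequentially] u(2) by simp
    then have "(\<lambda>n. z + u n) \<longlonglongrightarrow> z + 0" by (intro tendsto_add tendsto_const)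
    then have lim: "(\<lambda>n. z + u n) \<longlonglongrightarrow> z" by simp
    have mem: "z + u n \<in> span (B \<union> Y)" for n
    proof -
      have "S (z + u n - y n) = 0"
        by (simp add: S.diff S.add u z y)
      then have "z + u n - y n \<in> span B" using S0 B(3) by blast
      then have "z + u n - y n \<in> span (B \<union> Y)" using span_mono[of B "B \<union> Y"] by auto
      moreover have "y n \<in> span (B \<union> Y)" by (rule span_base) (simp add: y)
      ultimately have "(z + u n - y n) + y n \<in> span (B \<union> Y)" by (rule span_add)
      then show ?thesis by simp
    qed
    \<comment> \<open>Dropping the kernel part of \<open>z\<close> does not change its image, so
      \<open>l\<close> is attained on \<open>Y\<close>.\<close>
    have "z \<in> span (B \<union> Y)" by (rule closed_sequentially[OF clBY mem lim])
    then obtain p q where pq: "z = p + q" "p \<in> span B" "q \<in> span Y"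
      unfolding span_Un by blast
    have "q \<in> Y" using pq(3) span_minimal[OF subset_refl sY] by blast
    moreover have "l = S q" using spanB[OF pq(2)] by (simp add: z pq(1) S.add)
    ultimately show "l \<in> S ` Y" by blast
  qed
  have sSY: "bs.subspace (S ` Y)"
  proof (rule bs.subspaceI)
    show "0 \<in> S ` Y" using subspace_0[OF sY] S.zero by force
    fix x y c assume "x \<in> S ` Y"
    then obtain a where a: "a \<in> Y" "x = S a" by blast
    show "?bs c x \<in> S ` Y"
      unfolding a Slin(2)[symmetric] by (rule imageI[OF subspace_scale[OF sY a(1)]])
    assume "y \<in> S ` Y"
    then obtain b where b: "b \<in> Y" "y = S b" by blast
    show "x + y \<in> S ` Y"
      unfolding a b Slin(1)[symmetric] by (rule imageI[OF subspace_add[OF sY a(1) b(1)]])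
  qed
  obtain F where F: "complement_basis (\<lambda>c (f :: 'z \<Rightarrow> 'k) x. c * f x) {0} (annihilator Y) F" "finite F"
    using rel_dim_annihilator[OF Y] by (auto simp: rel_dim_def)
  have Fspan: "annihilator Y = fs.span F"
    using F(1) by (auto simp: complement_basis_def)
  have FD: "F \<subseteq> carrier ?D"
    using fs.complement_basis_subset(3)[OF F(1)] by (auto simp: annihilator_def)
  define G where "G = Blinfun ` F"
  have aG: "blinfun_apply ` G = F"
  proof -
    have "blinfun_apply (Blinfun f) = f" if "f \<in> F" for f
      using FD that by (intro bounded_linear_Blinfun_apply bounded_linear_functional) auto
    then show ?thesis by (force simp: G_def image_image)
  qed
  \<comment> \<open>\<open>G\<close> is the copy of a finite basis of the annihilator; the linear
    map \<open>blinfun_apply\<close> carries this span to the sum in question.\<close>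
  have cl: "closed (bs.span (G \<union> S ` Y))"
    using F(2) by (intro bs.closed_span_Un_finite[OF sSY clSY]) (simp add: G_def)
  interpret ap: Vector_Spaces.linear ?bs "\<lambda>c (f :: 'z \<Rightarrow> 'k) x. c * f x" blinfun_apply
    by unfold_locales (auto simp: fun_eq_iff blinfun.add_left)
  have "blinfun_apply ` bs.span (G \<union> S ` Y) = fs.span (F \<union> T ` Y)"
    by (simp add: ap.span_image[symmetric] image_Un aG image_image S)
  also have "\<dots> = {l + g |l g. l \<in> annihilator Y \<and> g \<in> T ` Y}"
  proof -
    have "blinfun_apply ` bs.span (S ` Y) = fs.span (T ` Y)"
      by (simp add: ap.span_image[symmetric] image_image S)
    moreover have "bs.span (S ` Y) = S ` Y"
      by (rule bs.span_eq_iff[THEN iffD2, OF sSY])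
    ultimately have "fs.span (T ` Y) = T ` Y" by (simp add: image_image S)
    then show ?thesis by (simp only: fs.span_Un Fspan)
  qed
  finally have im: "blinfun_apply ` bs.span (G \<union> S ` Y) = {l + g |l g. l \<in> annihilator Y \<and> g \<in> T ` Y}" .
  have "{w. blinfun_apply w \<in> blinfun_apply ` bs.span (G \<union> S ` Y)} = bs.span (G \<union> S ` Y)"
    by (auto simp: blinfun_apply_inject)
  then show ?thesis using cl unfolding im by simp
qed

end

section \<open>The compression and its index\<close>

lemma adj_inclusion_compression:
  assumes "y \<in> Y"
  shows "(adj (subsp sc Y) (inclusion Y) \<circ> T \<circ> inclusion Y) y = (\<lambda>x. if x \<in> Y then T y x else 0)"
  \<comment> \<open>\<open>inclusion Y\<close> is \<open>undefined\<close> off \<open>Y\<close>: the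
    assumption on \<open>y\<close> covers its inner occurrence, the guard in \<open>adj\<close> the
    outer one.\<close>
  using assms by (auto simp: adj_def inclusion_def subsp_def fun_eq_iff)

text \<open>The annihilator is the kernel of restriction, so \<open>?W\<close> is the full preimage
  of the range of the compression, and both have codimension \<open>c2\<close>. The kernel of the
  compression has dimension \<open>k2\<close>, and \<open>k2 + k = k + c2\<close> gives index
  zero.\<close>

theorem propositionA5:
  fixes sc :: "'k::{real_normed_field,banach} \<Rightarrow> 'z::banach \<Rightarrow> 'z"
    and Y :: "'z set" and T :: "'z \<Rightarrow> ('z \<Rightarrow> 'k)"
  defines "Z\<^sub>s \<equiv> whole sc" and "Y\<^sub>s \<equiv> subsp sc Y"
  defines "T_hat \<equiv> adj Y\<^sub>s (inclusion Y) \<circ> T \<circ> inclusion Y"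
  assumes "banach_space_over sc"
    and "module.subspace sc Y" and "closed Y" and "finite_codim Z\<^sub>s Y"
    and "T \<in> bounded_operators Z\<^sub>s (dual Z\<^sub>s)"
    and "fredholm Z\<^sub>s (dual Z\<^sub>s) T" and "fredholm_index Z\<^sub>s (dual Z\<^sub>s) T = 0"
  shows "T_hat \<in> bounded_operators Y\<^sub>s (dual Y\<^sub>s)
    \<and> fredholm Y\<^sub>s (dual Y\<^sub>s) T_hat \<and> fredholm_index Y\<^sub>s (dual Y\<^sub>s) T_hat = 0"
proof -
  interpret banach_space_over sc by fact
  interpret fs: vector_space "\<lambda>c (f :: 'z \<Rightarrow> 'k) x. c * f x" by (rule vector_space_fun)
  interpret zf: vector_space_pair sc "\<lambda>c (f :: 'z \<Rightarrow> 'k) x. c * f x" ..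
  interpret ff: vector_space_pair "\<lambda>c (f :: 'z \<Rightarrow> 'k) x. c * f x" "\<lambda>c (f :: 'z \<Rightarrow> 'k) x. c * f x" ..
  let ?fs = "\<lambda>c (f :: 'z \<Rightarrow> 'k) x. c * f x"
  let ?D = "dual (whole sc)" and ?DY = "dual (subsp sc Y)"
  \<comment> \<open>The adjoint of the inclusion as a linear map on the whole function type; the
    value 0 off \<open>Y\<close> is what the carrier of the dual of \<open>Y\<close>
    requires.\<close>
  define R where "R f = (\<lambda>x. if x \<in> Y then f x else 0)" for f :: "'z \<Rightarrow> 'k"
  have sY: "subspace Y" and cY: "closed Y" by fact+
  have That: "T_hat y = R (T y)" if "y \<in> Y" for y
    unfolding T_hat_def Y\<^sub>s_def R_def by (rule adj_inclusion_compression[OF that])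
  have T: "T \<in> bounded_operators (whole sc) ?D" using assms by simp
  have TD: "T z \<in> carrier ?D" for z
    using T by (auto simp: bounded_operators_def subsp_def)
  have Tadd: "T (x + y) = T x + T y" and Tscale: "T (sc c x) = (\<lambda>z. c * T x z)" for x y c
    using T by (auto simp: bounded_operators_def subsp_def scl_dual)
  interpret T: Vector_Spaces.linear sc ?fs T
    by unfold_locales (simp_all add: Tadd Tscale)
  interpret R: Vector_Spaces.linear ?fs ?fs R
    by unfold_locales (auto simp: R_def fun_eq_iff)
  have RD: "R f \<in> carrier ?DY" if "f \<in> carrier ?D" for f
    using that unfolding carrier_dual_subsp R_def
    using subspace_add[OF sY] subspace_scale[OF sY] by auto
  have sD: "fs.subspace (carrier ?D)" and sDY: "fs.subspace (carrier ?DY)"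
    using subspace_dual sY by auto
  have whole: "carrier (whole sc) = UNIV" "scl (whole sc) = sc"
    "carrier (subsp sc Y) = Y" "scl (subsp sc Y) = sc"
    by (simp_all add: subsp_def)
  have ranT: "ran (whole sc) T = range T" by (simp add: ran_def whole)
  have kerT: "ker (whole sc) T = {x \<in> UNIV. T x = 0}" by (simp add: ker_def whole)
  have F: "finite_dim (whole sc) (ker (whole sc) T)"
    "closedin (ntopology ?D) (range T)" "finite_codim ?D (range T)"
    using \<open>fredholm Z\<^sub>s (dual Z\<^sub>s) T\<close> by (simp_all add: fredholm_def Z\<^sub>s_def ranT)
  define k where "k = dim (ker (whole sc) T)"
  have k: "rel_dim sc {0} {x \<in> UNIV. T x = 0} k"
    using rel_dim_zero_iff[of "whole sc" "ker (whole sc) T" k] F(1) T.subspace_kernel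
    unfolding kerT by (simp add: k_def kerT whole)
  have sranT: "fs.subspace (range T)" by (rule T.subspace_image[OF subspace_UNIV])
  \<comment> \<open>Index zero lets the kernel dimension and the codimension share the letter
    \<open>k\<close>.\<close>
  have "codim ?D (range T) = k"
    using \<open>fredholm_index Z\<^sub>s (dual Z\<^sub>s) T = 0\<close>
    by (simp add: fredholm_index_def Z\<^sub>s_def ranT whole k_def)
  then have c: "rel_dim ?fs (range T) (carrier ?D) k"
    using fs.rel_dim_codim[of ?D "range T" k, OF scl_dual sD sranT] TD F(3) by auto
  define n where "n = codim (whole sc) Y"
  have n: "rel_dim sc Y UNIV n"
    using rel_dim_codim[of "whole sc" Y n] \<open>finite_codim Z\<^sub>s Y\<close> sY
    by (simp add: whole n_def Z\<^sub>s_def)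
  have annD: "annihilator Y \<subseteq> carrier ?D" by (auto simp: annihilator_def)
  let ?W = "{l + w |l w. l \<in> annihilator Y \<and> w \<in> T ` Y}"
  obtain k2 c2 where kc: "rel_dim sc {0} {x \<in> Y. T x \<in> annihilator Y} k2"
    "rel_dim ?fs ?W (carrier ?D) c2" "k2 + k = k + c2"
    using zf.rel_dim_compression[OF T.linear_axioms n rel_dim_annihilator[OF cY n] annD k c] by blast
  obtain P C where P: "Vector_Spaces.linear sc sc P" "\<And>x. P x \<in> Y" "\<And>y. y \<in> Y \<Longrightarrow> P y = y"
    "0 \<le> C" "\<And>x. norm (P x) \<le> C * norm x"
    using complement_projection[OF cY n] by blast
  interpret P: Vector_Spaces.linear sc sc P by (rule P(1))
  \<comment> \<open>Extension of functionals from \<open>Y\<close>; since \<open>P\<close> fixes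
    \<open>Y\<close>, restricting by \<open>R\<close> recovers \<open>g\<close>.\<close>
  have gP: "(\<lambda>x. g (P x)) \<in> carrier ?D" if g: "g \<in> carrier ?DY" for g
  proof -
    have "norm (g (P x)) \<le> (nrm ?DY g * C) * norm x" for x
    proof -
      have "norm (g (P x)) \<le> nrm ?DY g * norm (P x)" by (rule norm_le_nrm_dual[OF sY g P(2)])
      also have "\<dots> \<le> nrm ?DY g * (C * norm x)"
        by (rule mult_left_mono[OF P(5) nrm_dual_nonneg[OF sY g]])
      finally show ?thesis by (simp only: mult.assoc)
    qed
    then show ?thesis
      using g P(2) unfolding carrier_dual_subsp by (auto simp: P.add P.scale)
  qed
  have RgP: "R (\<lambda>x. g (P x)) = g" if "g \<in> carrier ?DY" for g
    using that P(3) by (auto simp: R_def carrier_dual_subsp fun_eq_iff)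
  have ann: "f - T y \<in> annihilator Y" if "f \<in> carrier ?D" "R f = R (T y)" for f y
  proof -
    have "f x = T y x" if "x \<in> Y" for x
      using fun_cong[OF \<open>R f = R (T y)\<close>, of x] that by (simp add: R_def)
    then show ?thesis
      using diff_in_dual[OF subspace_UNIV that(1) TD] by (simp add: annihilator_def)
  qed
  have R_ann: "R l = 0" if "l \<in> annihilator Y" for l
    using that by (auto simp: R_def annihilator_def fun_eq_iff)
  have ranTh: "ran (subsp sc Y) T_hat = R ` T ` Y"
    using That by (auto simp: ran_def whole image_image)
  have preimage: "?W = {u \<in> carrier ?D. R u \<in> R ` T ` Y}"
  proof (intro equalityI subsetI)
    fix u assume "u \<in> ?W"
    then obtain l y where u: "u = l + T y" "l \<in> annihilator Y" "y \<in> Y" by blast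
    have "R u = R (T y)" by (simp add: u(1) R.add R_ann[OF u(2)])
    moreover have "u \<in> carrier ?D"
      unfolding u(1) using annD u(2) TD by (intro fs.subspace_add[OF sD]) auto
    ultimately show "u \<in> {u \<in> carrier ?D. R u \<in> R ` T ` Y}" using u(3) by blast
  next
    fix u assume "u \<in> {u \<in> carrier ?D. R u \<in> R ` T ` Y}"
    then obtain y where y: "u \<in> carrier ?D" "y \<in> Y" "R u = R (T y)" by blast
    have "u = (u - T y) + T y" by simp
    then show "u \<in> ?W" using ann[OF y(1,3)] y(2) by blast
  qed
  have sRT: "fs.subspace (R ` T ` Y)"
    by (rule R.subspace_image[OF T.subspace_image[OF sY]])
  \<comment> \<open>Surjectivity of \<open>R\<close>, in the form modulo a subspace that
    \<open>rel_dim_iso\<close> expects.\<close>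
  have surj: "carrier ?DY = {R u + v |u v. u \<in> carrier ?D \<and> v \<in> R ` T ` Y}"
  proof (intro equalityI subsetI)
    fix g assume g: "g \<in> carrier ?DY"
    have "g = R (\<lambda>x. g (P x)) + 0" using RgP[OF g] by simp
    then show "g \<in> {R u + v |u v. u \<in> carrier ?D \<and> v \<in> R ` T ` Y}"
      using gP[OF g] fs.subspace_0[OF sRT] by blast
  next
    fix g assume "g \<in> {R u + v |u v. u \<in> carrier ?D \<and> v \<in> R ` T ` Y}"
    then obtain u y where "g = R u + R (T y)" "u \<in> carrier ?D" by blast
    then show "g \<in> carrier ?DY"
      using fs.subspace_add[OF sDY RD RD] TD by blast
  qed
  have codim: "rel_dim ?fs (R ` T ` Y) (carrier ?DY) c2"
    by (rule iffD1[OF ff.rel_dim_iso[OF R.linear_axioms sD sRT surj preimage] kc(2)])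
  have RTD: "R ` T ` Y \<subseteq> carrier ?DY" using RD TD by blast
  have kerTh: "ker (subsp sc Y) T_hat = {x \<in> Y. T x \<in> annihilator Y}"
  proof -
    have "R (T y) = 0 \<longleftrightarrow> T y \<in> annihilator Y" for y
    proof
      assume "R (T y) = 0"
      \<comment> \<open>Writing zero as \<open>R (T 0)\<close> makes \<open>ann\<close> applicable
        with 0 as the second point.\<close>
      then have "R (T y) = R (T 0)" by (simp add: T.zero R.zero)
      from ann[OF TD this] show "T y \<in> annihilator Y" by (simp add: T.zero)
    qed (rule R_ann)
    then show ?thesis using That by (auto simp: ker_def whole)
  qed
  have bdd: "T_hat \<in> bounded_operators (subsp sc Y) ?DY"
  proof -
    obtain K where K: "\<And>x. nrm ?D (T x) \<le> K * norm x"
      using T by (auto simp: bounded_operators_def subsp_def)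
    have "nrm ?DY (R (T y)) \<le> K * norm y" if "y \<in> Y" for y
    proof -
      have "nrm ?DY (R (T y)) \<le> nrm ?D (T y)"
      proof (rule nrm_dual_le[OF sY nrm_dual_nonneg[OF subspace_UNIV TD]])
        fix x assume "x \<in> Y"
        then show "norm (R (T y) x) \<le> nrm ?D (T y) * norm x"
          using norm_le_nrm_dual[OF subspace_UNIV TD UNIV_I] by (simp add: R_def)
      qed
      then show ?thesis using K[of y] by simp
    qed
    moreover have "nrm (subsp sc Y) = norm" by (simp add: subsp_def)
    ultimately show ?thesis
      using RD TD subspace_add[OF sY] subspace_scale[OF sY]
      unfolding bounded_operators_def
      by (auto simp: whole That T.add R.add T.scale R.scale scl_dual)
  qed
  have closed_ran: "closedin (ntopology ?DY) (R ` T ` Y)"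
    unfolding closedin_dual_iff[OF sY]
  proof (intro conjI RTD allI impI)
    fix \<sigma> g
    assume \<sigma>: "\<forall>n. \<sigma> n \<in> R ` T ` Y" and g: "g \<in> carrier ?DY"
      and lim: "(\<lambda>n. nrm ?DY (\<sigma> n - g)) \<longlonglongrightarrow> 0"
    have \<sigma>D: "\<sigma> n \<in> carrier ?DY" for n using \<sigma> RTD by blast
    \<comment> \<open>Extension by \<open>P\<close> as a map into the operator type. It is bounded
      with constant \<open>C\<close>, and for \<open>h\<close> in the dual of \<open>Y\<close> the
      operator \<open>E h\<close> lies over \<open>?W\<close> exactly when \<open>h\<close> lies in
      the range of the compression; closedness is thus inherited from \<open>?W\<close>.\<close>
    define E where "E h = Blinfun (\<lambda>x. h (P x))" for h :: "'z \<Rightarrow> 'k"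
    have E: "blinfun_apply (E h) = (\<lambda>x. h (P x))" if "h \<in> carrier ?DY" for h
      unfolding E_def by (rule bounded_linear_Blinfun_apply[OF bounded_linear_functional[OF gP[OF that]]])
    have inW: "E (\<sigma> n) \<in> {w. blinfun_apply w \<in> ?W}" for n
      unfolding preimage mem_Collect_eq[of "E (\<sigma> n)"] E[OF \<sigma>D] using gP[OF \<sigma>D] RgP[OF \<sigma>D] \<sigma> by simp
    have "(\<lambda>n. E (\<sigma> n) - E g) \<longlonglongrightarrow> 0"
    proof (rule Lim_null_comparison)
      have "(\<lambda>n. nrm ?DY (\<sigma> n - g) * C) \<longlonglongrightarrow> 0 * C"
        by (intro tendsto_mult lim tendsto_const)
      then show "(\<lambda>n. nrm ?DY (\<sigma> n - g) * C) \<longlonglongrightarrow> 0" by simp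
      show "\<forall>\<^sub>F n in sequentially. norm (E (\<sigma> n) - E g) \<le> nrm ?DY (\<sigma> n - g) * C"
      proof (rule always_eventually, rule allI, rule norm_blinfun_bound)
        fix n x
        note d = diff_in_dual[OF sY \<sigma>D g, of n]
        show "0 \<le> nrm ?DY (\<sigma> n - g) * C"
          by (rule mult_nonneg_nonneg[OF nrm_dual_nonneg[OF sY d] P(4)])
        have "norm ((\<sigma> n - g) (P x)) \<le> nrm ?DY (\<sigma> n - g) * norm (P x)"
          by (rule norm_le_nrm_dual[OF sY d P(2)])
        also have "\<dots> \<le> nrm ?DY (\<sigma> n - g) * (C * norm x)"
          by (rule mult_left_mono[OF P(5) nrm_dual_nonneg[OF sY d]])
        finally show "norm (blinfun_apply (E (\<sigma> n) - E g) x) \<le> nrm ?DY (\<sigma> n - g) * C * norm x"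
          by (simp add: blinfun.diff_left E[OF \<sigma>D] E[OF g] mult.assoc)
      qed
    qed
    then have E_lim: "(\<lambda>n. E (\<sigma> n)) \<longlonglongrightarrow> E g" by (rule LIM_zero_cancel)
    have "E g \<in> {w. blinfun_apply w \<in> ?W}"
      by (rule closed_sequentially[OF closed_annihilator_plus_image[OF cY n T F(1,2)]
            inW E_lim])
    then have "R (blinfun_apply (E g)) \<in> R ` T ` Y" unfolding preimage by simp
    then show "g \<in> R ` T ` Y" unfolding E[OF g] RgP[OF g] .
  qed
  have "finite_codim ?DY (R ` T ` Y)" "codim ?DY (R ` T ` Y) = c2"
    using fs.rel_dim_codim[of ?DY, OF scl_dual sDY sRT RTD] codim by blast+
  moreover have "finite_dim (subsp sc Y) (ker (subsp sc Y) T_hat)" "dim (ker (subsp sc Y) T_hat) = k2"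
    using rel_dim_zero_iff[of "subsp sc Y" _ k2, OF whole(4) rel_dim_subspaces(2)[OF kc(1)]] kc(1)
    unfolding kerTh by blast+
  ultimately show ?thesis
    using bdd closed_ran kc(3)
    by (simp add: fredholm_def fredholm_index_def Y\<^sub>s_def ranTh whole)
qed

end
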